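(* Let $n\geq 1$ and let $\overline{H_1},\overline{H_2}$ be irreducible subgroups of $PSL(n,\mathbb{C})$, with preimages $H_i=\pi_n^{-1}(\overline{H_i})\le SL(n,\mathbb{C})$. Then $Z_{PSL(n,\mathbb{C})}(\overline{H_1})$ and $Z_{PSL(n,\mathbb{C})}(\overline{H_2})$ are conjugate in $PSL(n,\mathbb{C})$ if and only if the associated alternate modules $(Z_{PSL(n,\mathbb{C})}(\overline{H_1}),\phi_{H_1})$ and $(Z_{PSL(n,\mathbb{C})}(\overline{H_2}),\phi_{H_2})$ are isometric.
   Context: Let $\xi=e^{2\pi i/n}$ and $\pi_n:SL(n,\mathbb{C})\to PSL(n,\mathbb{C})=SL(n,\mathbb{C})/\langle\xi I_n\rangle$. A subgroup of $SL(n,\mathbb{C})$ is irreducible if no nonzero proper subspace of $\mathbb{C}^n$ is invariant; a subgroup of $PSL(n,\mathbb{C})$ is irreducible if its preimage is. For $H$ irreducible in $SL(n,\mathbb{C})$, let $Z_n(H)=Z_{PSL(n,\mathbb{C})}(\pi_n(H))$ (a finite abelian group) and $U_n(H)=\pi_n^{-1}(Z_n(H))$. The associated alternate module is $(Z_n(H),\phi_H)$ where, for $a,b\in Z_n(H)$ with lifts $\hat a,\hat b\in U_n(H)$, $\hat a\hat b\hat a^{-1}\hat b^{-1}=\xi^kI_n$ and $\phi_H(a,b)=k/n\in\mathbb{Q}/\mathbb{Z}$ (independent of lifts). An alternate module is a finite abelian group $A$ with a biadditive $\phi:A\times A\to\mathbb{Q}/\mathbb{Z}$ with $\phi(a,a)=0$;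 an isometry is a form-preserving group isomorphism. *)

theory Defs
  imports "HOL-Analysis.Analysis"
begin

type_synonym 'n cmat = "complex^'n^'n"

definition SL :: "('n::finite) cmat set" where
  "SL = {A. det A = 1}"

definition root_scalar :: "nat \<Rightarrow> ('n::finite) cmat" where
  "root_scalar k = mat (cis (2 * pi * real k / real CARD('n)))"

text \<open>pi_n: SL(n,C) \<rightarrow> PSL(n,C); an element of PSL is the coset of its lifts.\<close>
definition pi_n :: "('n::finite) cmat \<Rightarrow> 'n cmat set" where
  "pi_n A = {root_scalar k ** A | k. True}"

definition PSL :: "('n::finite) cmat set set" where
  "PSL = pi_n ` SL"

text \<open>Group operations of PSL on cosets (well defined since the scalars are central).\<close>
definition psl_mult :: "('n::finite) cmat set \<Rightarrow> 'n cmat set \<Rightarrow> 'n cmat set" where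
  "psl_mult a b = {x ** y | x y. x \<in> a \<and> y \<in> b}"

definition psl_inv :: "('n::finite) cmat set \<Rightarrow> 'n cmat set" where
  "psl_inv a = matrix_inv ` a"

definition psl_subgroup :: "('n::finite) cmat set set \<Rightarrow> bool" where
  "psl_subgroup G \<longleftrightarrow> G \<subseteq> PSL \<and> pi_n (mat 1) \<in> G \<and>
     (\<forall>a\<in>G. \<forall>b\<in>G. psl_mult a b \<in> G) \<and> (\<forall>a\<in>G. psl_inv a \<in> G)"

definition csubspace :: "(complex^'n) set \<Rightarrow> bool" where
  "csubspace V \<longleftrightarrow> 0 \<in> V \<and> (\<forall>x\<in>V. \<forall>y\<in>V. x + y \<in> V) \<and> (\<forall>c. \<forall>x\<in>V. c *s x \<in> V)"

definition irreducible_SL :: "('n::finite) cmat set \<Rightarrow> bool" where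
  "irreducible_SL H \<longleftrightarrow>
     \<not> (\<exists>V. csubspace V \<and> V \<noteq> {0} \<and> V \<noteq> UNIV \<and> (\<forall>h\<in>H. \<forall>v\<in>V. h *v v \<in> V))"

definition psl_preimage :: "('n::finite) cmat set set \<Rightarrow> 'n cmat set" where
  "psl_preimage G = \<Union>G"

definition irreducible_PSL :: "('n::finite) cmat set set \<Rightarrow> bool" where
  "irreducible_PSL G \<longleftrightarrow> irreducible_SL (psl_preimage G)"

definition psl_centralizer :: "('n::finite) cmat set set \<Rightarrow> 'n cmat set set" where
  "psl_centralizer G = {z \<in> PSL. \<forall>h\<in>G. psl_mult z h = psl_mult h z}"

text \<open>The alternate form phi(a,b) = k/n in Q/Z, represented by its representative in [0,1),
  where hat a hat b hat a^{-1} hat b^{-1} = xi^k I_n for (chosen) lifts.\<close>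
definition alt_form :: "('n::finite) cmat set \<Rightarrow> 'n cmat set \<Rightarrow> rat" where
  "alt_form a b = (let x = (SOME x. x \<in> a); y = (SOME y. y \<in> b) in
     (THE q. \<exists>k < CARD('n). q = of_nat k / of_nat CARD('n) \<and>
        x ** y ** matrix_inv x ** matrix_inv y = root_scalar k))"

definition alt_isometric ::
  "('n::finite) cmat set set \<Rightarrow> ('n cmat set \<Rightarrow> 'n cmat set \<Rightarrow> rat) \<Rightarrow>
   'n cmat set set \<Rightarrow> ('n cmat set \<Rightarrow> 'n cmat set \<Rightarrow> rat) \<Rightarrow> bool" where
  "alt_isometric A1 phi1 A2 phi2 \<longleftrightarrow>
     (\<exists>f. bij_betw f A1 A2 \<and>
          (\<forall>a\<in>A1. \<forall>b\<in>A1. f (psl_mult a b) = psl_mult (f a) (f b)) \<and>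
          (\<forall>a\<in>A1. \<forall>b\<in>A1. phi2 (f a) (f b) = phi1 a b))"

definition psl_conjugate :: "('n::finite) cmat set set \<Rightarrow> 'n cmat set set \<Rightarrow> bool" where
  "psl_conjugate A B \<longleftrightarrow>
     (\<exists>g\<in>PSL. (\<lambda>z. psl_mult (psl_mult g z) (psl_inv g)) ` A = B)"

end

(* By Schur's lemma, lifts of two elements of a centralizer Z commute up to a scalar, and a lift of a
   nontrivial element of Z has trace 0. The lifts of Z thus form a projective representation on C^n
   whose character is n times the indicator of the identity, and Z is finite since lifts of distinct
   elements are trace-orthogonal. An isometry f gives a second projective representation of the same
   group, a |-> lift of f a, with the same commutator scalars. After rescaling, the two factor sets
   agree; having equal characters, the two representations are then equivalent, and an invertible
   intertwiner, scaled to determinant 1, conjugates one centralizer onto the other. *)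
theory Submission
  imports Defs "HOL-Computational_Algebra.Fundamental_Theorem_Algebra"
begin

section \<open>Matrices\<close>

text \<open>Why the rescaling exists: the quotient of the two factor sets is a 2-cocycle of a finite
  abelian group, symmetric because the commutator scalars agree, and such a cocycle with values in
  the divisible group of nonzero complex numbers is a coboundary. Rather than splitting the group
  into cyclic factors, the proof reads the rescaling off as the eigenvalues of a common eigenvector
  of commuting operators on the matrix space.

  The rescaling is not under control, so the comparison of characters has to survive it. It does: a
  nontrivial element has trace 0 whatever the scalar, and at the identity both lifts are scalar
  matrices, which the eigenvector makes equal.

  For the lifts of Z the space C^n is in general reducible (for a trivial Z they are all scalar), so
  uniqueness of an irreducible projective representation would not finish the argument;
  multiplicities must match too, and the character is what controls them. No decomposition into
  irreducibles is formed: an intertwiner of least nullity is shown to be invertible.\<close>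

definition smult_mat :: "'a::times \<Rightarrow> 'a^'n^'m \<Rightarrow> 'a^'n^'m" where
  "smult_mat c A = (\<chi> i j. c * A $ i $ j)"

lemma smult_mat_nth [simp]: "smult_mat c A $ i $ j = c * A $ i $ j"
  by (simp add: smult_mat_def)

lemma smult_mat_mult_left [simp]: "smult_mat c (A :: 'a::comm_semiring_1^'n^'m) ** B = smult_mat c (A ** B)"
  by (simp add: vec_eq_iff matrix_matrix_mult_def sum_distrib_left mult_ac)

lemma smult_mat_mult_right [simp]: "(A :: 'a::comm_semiring_1^'n^'m) ** smult_mat c B = smult_mat c (A ** B)"
  by (simp add: vec_eq_iff matrix_matrix_mult_def sum_distrib_left mult_ac)

lemma smult_mat_smult_mat [simp]: "smult_mat a (smult_mat b A) = smult_mat (a * b) (A :: 'a::comm_semiring_1^'n^'m)"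
  by (simp add: vec_eq_iff mult_ac)

lemma smult_mat_1 [simp]: "smult_mat 1 A = (A :: 'a::comm_semiring_1^'n^'m)"
  by (simp add: vec_eq_iff)

lemma smult_mat_zero_left [simp]: "smult_mat 0 A = (0 :: 'a::comm_semiring_1^'n^'m)"
  by (simp add: vec_eq_iff)

lemma mat_mult_eq_smult: "mat c ** A = smult_mat c (A :: 'a::comm_semiring_1^'n^'m)"
  by (simp add: vec_eq_iff matrix_matrix_mult_def mat_def if_distrib if_distribR cong: if_cong)

lemma mat_eq_smult: "mat c = smult_mat c (mat 1 :: 'a::comm_semiring_1^'n^'n)"
  by (simp add: vec_eq_iff mat_def)

lemma smult_mat_vec [simp]: "smult_mat c A *v v = c *s ((A :: 'a::comm_semiring_1^'n^'m) *v v)"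
  by (simp add: vec_eq_iff matrix_vector_mult_def sum_distrib_left mult_ac)

lemma transpose_smult_mat [simp]: "transpose (smult_mat c A) = smult_mat c (transpose A)"
  by (simp add: vec_eq_iff transpose_def)

text \<open>With products nested to the right, an equation for \<open>A ** B\<close> no longer
  matches inside a longer product. Applied through \<open>THEN\<close>, this rule supplies the form
  that does match.\<close>

lemma matrix_mult_assoc_cong: "A ** B = C \<Longrightarrow> A ** (B ** D) = C ** (D :: 'a::semiring_1^'n^'m)"
  by (simp add: matrix_mul_assoc)

lemma det_smult_mat: "det (smult_mat c A) = c ^ CARD('n) * det (A :: 'a::comm_ring_1^'n^'n)"
proof -
  have "det (mat c :: 'a^'n^'n) = c ^ CARD('n)" by (subst det_diagonal) (simp_all add: mat_def)
  then show ?thesis by (simp add: det_mul flip: mat_mult_eq_smult)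
qed

lemma trace_smult_mat: "trace (smult_mat c (A :: 'a::comm_semiring_1^'n^'n)) = c * trace A"
  by (simp add: trace_def sum_distrib_left)

lemma matrix_add_rdistrib: "((A :: 'a::semiring_1^'n^'m) + B) ** C = A ** C + B ** C"
  by (simp add: vec_eq_iff matrix_matrix_mult_def sum.distrib algebra_simps)

lemma matrix_diff_ldistrib: "(A :: 'a::ring_1^'n^'m) ** (B - C) = A ** B - A ** C"
  by (simp add: vec_eq_iff matrix_matrix_mult_def sum_subtractf algebra_simps)

lemma matrix_diff_rdistrib: "((A :: 'a::ring_1^'n^'m) - B) ** C = A ** C - B ** C"
  by (simp add: vec_eq_iff matrix_matrix_mult_def sum_subtractf algebra_simps)

lemma matrix_sum_left: "(\<Sum>a\<in>S. f a) ** (C :: 'a::semiring_1^'k^'n) = (\<Sum>a\<in>S. f a ** C)"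
proof (cases "finite S")
  case True
  then show ?thesis by (induction S) (auto simp: vec_eq_iff matrix_matrix_mult_def sum.distrib algebra_simps)
qed (auto simp: vec_eq_iff matrix_matrix_mult_def)

lemma matrix_sum_right: "(C :: 'a::semiring_1^'n^'k) ** (\<Sum>a\<in>S. f a) = (\<Sum>a\<in>S. C ** f a)"
proof (cases "finite S")
  case True
  then show ?thesis by (induction S) (auto simp: vec_eq_iff matrix_matrix_mult_def sum.distrib algebra_simps)
qed (auto simp: vec_eq_iff matrix_matrix_mult_def)

lemma matrix_vector_sum_left: "(\<Sum>a\<in>S. f a) *v (v :: 'a::semiring_1^'n) = (\<Sum>a\<in>S. f a *v v)"
proof (cases "finite S")
  case True
  then show ?thesis
    by (induction S) (auto simp: vec_eq_iff matrix_vector_mult_def sum.distrib algebra_simps)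
qed (auto simp: vec_eq_iff matrix_vector_mult_def)

lemma trace_sum: "trace (\<Sum>a\<in>S. f a :: 'a::comm_semiring_1^'n^'n) = (\<Sum>a\<in>S. trace (f a))"
  by (simp add: trace_def) (rule sum.swap)

section \<open>Eigenvectors, traces of idempotents, generalized inverses\<close>

text \<open>Some nonzero polynomial in \<open>A\<close> kills some nonzero vector of \<open>W\<close>; a linear factor of such a
  polynomial of least degree yields the eigenvector.\<close>
lemma eigenvector_in_subspace:
  fixes A :: "complex^'n^'n"
  assumes W: "vec.subspace W" and inv: "\<And>v. v \<in> W \<Longrightarrow> A *v v \<in> W"
    and w: "w \<in> W" "w \<noteq> 0"
  shows "\<exists>c v. v \<in> W \<and> v \<noteq> 0 \<and> A *v v = c *s v"
proof -
  define pw where "pw i v = (((*v) A) ^^ i) v" for i v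
  define ap where "ap p v = (\<Sum>i\<le>degree p. coeff p i *s pw i v)" for p v
  have pw_W: "pw i v \<in> W" if "v \<in> W" for i v
    by (induction i) (auto simp: pw_def that inv)
  have ap_W: "ap p v \<in> W" if "v \<in> W" for p v
    unfolding ap_def by (intro vec.subspace_sum W vec.subspace_scale pw_W that)
  have ap_eq: "ap p v = (\<Sum>i\<le>N. coeff p i *s pw i v)" if "degree p \<le> N" for p v N
    unfolding ap_def using that
    by (intro sum.mono_neutral_left) (auto simp: coeff_eq_0)
  have ap_pCons: "ap (pCons a p) v = a *s v + A *v (ap p v)" for a p v
  proof -
    have "ap (pCons a p) v = (\<Sum>i\<le>Suc (degree p). coeff (pCons a p) i *s pw i v)"
      by (rule ap_eq) (rule degree_pCons_le)
    also have "\<dots> = a *s v + (\<Sum>i\<le>degree p. coeff p i *s (A *v pw i v))"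
      by (subst sum.atMost_Suc_shift) (simp add: pw_def)
    also have "(\<Sum>i\<le>degree p. coeff p i *s (A *v pw i v)) = A *v (ap p v)"
      unfolding ap_def by (simp add: vec.linear_sum vec.linear_scale vec.sum vec.scale)
    finally show ?thesis .
  qed
  have ap_add: "ap (p + q) v = ap p v + ap q v" for p q v
    using ap_eq[of p "max (degree p) (degree q)" v] ap_eq[of q "max (degree p) (degree q)" v]
      ap_eq[of "p + q" "max (degree p) (degree q)" v] degree_add_le_max[of p q]
    by (simp add: sum.distrib vec.scale_left_distrib)
  have ap_smult: "ap (smult c p) v = c *s ap p v" for c p v
    using ap_eq[of "smult c p" "degree p" v] degree_smult_le[of c p]
    by (simp add: ap_def vec.scale_sum_right)
  have "\<exists>p. p \<noteq> 0 \<and> (\<exists>v\<in>W. v \<noteq> 0 \<and> ap p v = 0)"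
  proof -
    define N where "N = CARD('n)"
    show ?thesis
    \<comment> \<open>A set of vectors forgets repetitions. If two iterates coincide, the difference
      of two monomials kills \<open>w\<close>; otherwise \<open>N + 1\<close> distinct vectors in
      dimension \<open>N\<close> are dependent.\<close>
    proof (cases "inj_on (\<lambda>i. pw i w) {..N}")
      case False
      then obtain i j where ij: "i \<noteq> j" "pw i w = pw j w" by (auto simp: inj_on_def)
      have single: "ap (monom c k) w = c *s pw k w" for c k
        using ap_eq[of "monom c k" k w] degree_monom_le[of c k]
        by (simp add: if_distribR if_distrib sum.delta cong: if_cong)
      have "ap (monom 1 i + monom (-1) j) w = 0"
        unfolding ap_add single by (simp add: ij)
      moreover have "monom 1 i + monom (-1) j \<noteq> (0 :: complex poly)"
      proof
        assume "monom 1 i + monom (-1) j = (0 :: complex poly)"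
        then have "coeff (monom 1 i + monom (-1) j) i = (0 :: complex)" by simp
        then show False using ij(1) by simp
      qed
      ultimately show ?thesis using w by blast
    next
      case True
      have "vec.dependent ((\<lambda>i. pw i w) ` {..N})"
      proof (rule vec.dependent_biggerset_general)
        have "vec.dim ((\<lambda>i. pw i w) ` {..N}) \<le> CARD('n)"
          using vec.dim_subset_UNIV[of "(\<lambda>i. pw i w) ` {..N}"] vec_dim_card by (simp add: vec.dimension_def card_cart_basis)
        then show "finite ((\<lambda>i. pw i w) ` {..N}) \<Longrightarrow>
            vec.dim ((\<lambda>i. pw i w) ` {..N}) < card ((\<lambda>i. pw i w) ` {..N})"
          using card_image[OF True] by (simp add: N_def)
      qed
      then obtain u v where u: "v \<in> (\<lambda>i. pw i w) ` {..N}" "u v \<noteq> 0"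
        "(\<Sum>v\<in>(\<lambda>i. pw i w) ` {..N}. u v *s v) = 0"
        by (subst (asm) vec.dependent_finite) auto
      have s0: "(\<Sum>i\<le>N. u (pw i w) *s pw i w) = 0"
        using u(3) sum.reindex[OF True, of "\<lambda>v. u v *s v"] by simp
      define p where "p = (\<Sum>i\<le>N. monom (u (pw i w)) i)"
      have cp: "coeff p i = (if i \<le> N then u (pw i w) else 0)" for i
        by (simp add: p_def coeff_sum if_distrib sum.delta cong: if_cong)
      have "degree p \<le> N" by (rule degree_le) (simp add: cp)
      then have "ap p w = 0" using s0 by (simp add: ap_eq cp)
      moreover have "p \<noteq> 0"
      proof
        assume "p = 0"
        obtain i where "v = pw i w" "i \<le> N" using u(1) by auto
        then show False using u(2) cp[of i] \<open>p = 0\<close> by simp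
      qed
      ultimately show ?thesis using w by blast
    qed
  qed
  then obtain p where p: "p \<noteq> 0" "\<exists>v\<in>W. v \<noteq> 0 \<and> ap p v = 0"
    and least: "\<And>q. q \<noteq> 0 \<and> (\<exists>v\<in>W. v \<noteq> 0 \<and> ap q v = 0) \<Longrightarrow> degree p \<le> degree q"
    using exists_least_iff[of "\<lambda>d. \<exists>p. degree p = d \<and> p \<noteq> 0 \<and> (\<exists>v\<in>W. v \<noteq> 0 \<and> ap p v = 0)"]
    by (metis not_le_imp_less)
  then obtain v where v: "v \<in> W" "v \<noteq> 0" "ap p v = 0" by blast
  have "degree p \<noteq> 0"
  proof
    assume "degree p = 0"
    then obtain a where "p = [:a:]" using degree_eq_zeroE by blast
    then show False using p(1) v by (auto simp: ap_def pw_def)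
  qed
  then have "\<not> constant (poly p)" by (simp add: constant_degree)
  then obtain c where "poly p c = 0" using fundamental_theorem_of_algebra by blast
  then obtain q where q: "p = [:-c, 1:] * q" by (auto simp: poly_eq_0_iff_dvd elim: dvdE)
  have "q \<noteq> 0" using p(1) q by auto
  then have "degree q < degree p" using q by (subst q, subst degree_mult_eq) auto
  then have ne: "ap q v \<noteq> 0" using least[of q] \<open>q \<noteq> 0\<close> v by force
  have "p = smult (-c) q + pCons 0 q" using q by simp
  then have "ap p v = (-c) *s ap q v + A *v ap q v"
    by (simp only: ap_add ap_smult ap_pCons vec.scale_zero_left add_0_left)
  then have "A *v ap q v = c *s ap q v" using v(3) by (simp add: vec.scale_minus_left)
  with ne ap_W[OF v(1)] show ?thesis by blast
qed

text \<open>In a nonzero invariant subspace \<open>W\<close> of least dimension, each eigenspace of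
  \<open>T a\<close> is again invariant because the other operators commute with \<open>T a\<close>,
  so it is all of \<open>W\<close>. Hence every \<open>T a\<close> is a scalar on \<open>W\<close>,
  and any nonzero vector of \<open>W\<close> will do; no induction over \<open>S\<close> is
  involved.\<close>

lemma commuting_common_eigenvector:
  fixes T :: "'a \<Rightarrow> complex^'n^'n"
  assumes comm: "\<And>a b. a \<in> S \<Longrightarrow> b \<in> S \<Longrightarrow> T a ** T b = T b ** T a"
  shows "\<exists>v \<mu>. v \<noteq> 0 \<and> (\<forall>a\<in>S. T a *v v = \<mu> a *s v)"
proof -
  define P where "P W \<longleftrightarrow> vec.subspace W \<and> W \<noteq> {0} \<and> (\<forall>a\<in>S. \<forall>v\<in>W. T a *v v \<in> W)" for W
  have "(1 :: complex^'n) \<noteq> 0" by (simp add: vec_eq_iff)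
  then have "P UNIV" unfolding P_def by auto
  then obtain W where W: "P W" and least: "\<And>V. P V \<Longrightarrow> vec.dim W \<le> vec.dim V"
    using exists_least_iff[of "\<lambda>d. \<exists>W. vec.dim W = d \<and> P W"] by (metis not_le_imp_less)
  have sub: "vec.subspace W" using W by (simp add: P_def)
  obtain w where w: "w \<in> W" "w \<noteq> 0" using W vec.subspace_0 unfolding P_def by blast
  have "\<exists>c. \<forall>v\<in>W. T a *v v = c *s v" if a: "a \<in> S" for a
  proof -
    obtain c v where cv: "v \<in> W" "v \<noteq> 0" "T a *v v = c *s v"
      using eigenvector_in_subspace[OF sub _ w, of "T a"] W a unfolding P_def by blast
    define V where "V = {v\<in>W. T a *v v = c *s v}"
    have "vec.subspace V"
      using sub unfolding V_def vec.subspace_def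
      by (auto simp: vec.add vec.scale vec.scale_right_distrib mult.commute)
    moreover have "T b *v v \<in> V" if "b \<in> S" "v \<in> V" for b v
    proof -
      have "T a *v (T b *v v) = T b *v (T a *v v)"
        using comm[OF a that(1)] by (simp add: matrix_vector_mul_assoc)
      then show ?thesis using that W by (auto simp: V_def P_def vec.scale)
    qed
    ultimately have "P V" using cv unfolding P_def by (auto simp: V_def)
    then have "vec.dim W \<le> vec.dim V" by (rule least)
    then have "V = W"
      using vec.subspace_dim_equal[of V W] sub \<open>vec.subspace V\<close> by (auto simp: V_def)
    then show ?thesis by (auto simp: V_def)
  qed
  then obtain \<mu> where "\<And>a v. a \<in> S \<Longrightarrow> v \<in> W \<Longrightarrow> T a *v v = \<mu> a *s v" by metis
  with w show ?thesis by blast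
qed

text \<open>The trace is the dimension of the range. In a basis \<open>B\<close> extending a basis
  \<open>B1\<close> of the range, \<open>p\<close> fixes the vectors of \<open>B1\<close> and maps
  the others into the span of \<open>B1\<close>, so the diagonal entries are 1 on \<open>B1\<close>
  and 0 elsewhere. Characteristic 0 keeps the resulting positive integer nonzero.\<close>

lemma trace_idempotent_nonzero:
  fixes p :: "'a::field_char_0^'n^'n"
  assumes idem: "p ** p = p" and ne: "p \<noteq> 0"
  shows "trace p \<noteq> 0"
proof -
  let ?R = "range ((*v) p)"
  have fix_R: "p *v v = v" if "v \<in> ?R" for v
    using that idem by (auto simp: matrix_vector_mul_assoc)
  have subR: "vec.subspace ?R"
    by (intro vec.subspace_image) (auto simp: vec.subspace_UNIV)
  obtain B1 where B1: "B1 \<subseteq> ?R" "vec.independent B1" "?R \<subseteq> vec.span B1"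
    using vec.maximal_independent_subset[of ?R] by blast
  define B where "B = vec.extend_basis B1"
  have B: "B1 \<subseteq> B" "vec.independent B" "vec.span B = UNIV"
    using vec.extend_basis_superset vec.independent_extend_basis vec.span_extend_basis B1
    unfolding B_def by blast+
  have finB: "finite B" using B(2) by (rule vec.finiteI_independent)
  have "card B = CARD('n)"
    using vec.dim_eq_card_independent[OF B(2)] vec.dim_span[of B] B(3) vec_dim_card by metis
  then obtain g where g: "bij_betw g (UNIV :: 'n set) B"
    using finite_same_card_bij[of "UNIV :: 'n set" B] finB by auto
  define R where "R v = (\<chi> i. vec.representation B v (g i))" for v
  have linR: "Vector_Spaces.linear (*s) (*s) R"
    unfolding R_def
    by unfold_locales (auto simp: vec_eq_iff vec.representation_add B vec.representation_scale)
  \<comment> \<open>Change of basis: \<open>M\<close> has the vectors of \<open>B\<close> as columns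
    and \<open>N\<close> computes coordinates with respect to \<open>B\<close>. The diagonal of
    \<open>N ** (p ** M)\<close> thus consists of the coefficients of \<open>p *v b\<close> at
    \<open>b\<close>.\<close>
  define N where "N = matrix R"
  define M where "M = (\<chi> i j. g j $ i)"
  have N: "N *v v = R v" for v
    unfolding N_def by (rule matrix_works[OF linR])
  have M: "M *v v = (\<Sum>j\<in>UNIV. v $ j *s g j)" for v
    by (simp add: M_def matrix_vector_mult_def vec_eq_iff mult.commute)
  have "M *v (N *v v) = v" for v
  proof -
    have "M *v (N *v v) = (\<Sum>j\<in>UNIV. vec.representation B v (g j) *s g j)"
      by (simp add: M N R_def)
    also have "\<dots> = (\<Sum>b\<in>B. vec.representation B v b *s b)"
      by (rule sum.reindex_bij_betw[OF g])
    also have "\<dots> = v"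
      by (rule vec.sum_representation_eq) (auto simp: B finB)
    finally show ?thesis .
  qed
  then have MN: "M ** N = mat 1"
    by (simp add: matrix_eq matrix_vector_mul_assoc)
  have "trace p = trace (p ** M ** N)" using MN by (simp add: matrix_mul_assoc[symmetric])
  also have "\<dots> = trace (N ** (p ** M))" by (rule trace_mul_sym)
  also have "\<dots> = (\<Sum>j\<in>UNIV. vec.representation B (p *v g j) (g j))"
  proof -
    have "(N ** (p ** M)) $ j $ j = vec.representation B (p *v g j) (g j)" for j
    proof -
      have "(N ** (p ** M)) $ j $ j = ((N ** (p ** M)) *v axis j 1) $ j"
        by (simp add: matrix_vector_mult_def axis_def if_distrib if_distribR cong: if_cong)
      also have "\<dots> = R (p *v (M *v axis j 1)) $ j"
        by (simp add: matrix_vector_mul_assoc[symmetric] N)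
      also have "M *v axis j 1 = g j"
        by (simp add: M axis_def if_distrib if_distribR vec_eq_iff cong: if_cong)
      finally show ?thesis by (simp add: R_def)
    qed
    then show ?thesis by (simp add: trace_def)
  qed
  also have "\<dots> = (\<Sum>b\<in>B. vec.representation B (p *v b) b)"
    by (rule sum.reindex_bij_betw[OF g])
  also have "\<dots> = (\<Sum>b\<in>B. if b \<in> B1 then 1 else 0)"
  proof (rule sum.cong[OF refl])
    fix b assume b: "b \<in> B"
    show "vec.representation B (p *v b) b = (if b \<in> B1 then 1 else 0)"
    proof (cases "b \<in> B1")
      case True
      then show ?thesis using B1(1) fix_R[of b] vec.representation_basis[OF B(2) b] by auto
    next
      case False
      have "p *v b \<in> vec.span B1" using B1(3) by blast
      then have "vec.representation B (p *v b) = vec.representation B1 (p *v b)"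
        by (intro vec.representation_extend B)
      then show ?thesis using False vec.representation_ne_zero[of B1 "p *v b" b] by auto
    qed
  qed
  also have "\<dots> = of_nat (card B1)"
    using B(1) finB by (simp add: sum.If_cases Int_absorb1 flip: of_nat_sum)
  finally have "trace p = of_nat (card B1)" .
  moreover have "B1 \<noteq> {}"
  proof
    assume "B1 = {}"
    then have "p *v v = 0" for v using B1(3) by auto
    then have "p = 0" by (simp add: matrix_eq)
    with ne show False ..
  qed
  moreover have "finite B1" using B(1) finB by (rule finite_subset)
  ultimately show ?thesis by simp
qed

text \<open>\<open>g\<close> picks preimages under \<open>X\<close> linearly on the range of
  \<open>X\<close>. The result ignores any group action; it becomes equivariant later, by
  averaging.\<close>

lemma exists_generalized_inverse:
  fixes X :: "'a::field^'n^'n"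
  shows "\<exists>Y. X ** Y ** X = X"
proof -
  obtain g where g: "Vector_Spaces.linear (*s) (*s) g" "\<And>v. v \<in> range ((*v) X) \<Longrightarrow> X *v g v = v"
    using vec.linear_exists_right_inverse_on[OF matrix_vector_mul_linear_gen[of X] vec.subspace_UNIV]
    by blast
  have "X *v (matrix g *v (X *v v)) = X *v v" for v
    by (simp add: matrix_works[OF g(1)] g(2))
  then have "X ** matrix g ** X = X"
    by (simp add: matrix_eq matrix_vector_mul_assoc[symmetric])
  then show ?thesis by blast
qed

lemma exists_complex_root:
  assumes "c \<noteq> 0" "n > 0"
  shows "\<exists>t :: complex. t ^ n = c"
proof -
  have "card {z. z ^ n = c} = n" by (rule Complex.card_nth_roots) fact+
  then have "card {z. z ^ n = c} \<noteq> 0" using assms(2) by linarith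
  then have "{z. z ^ n = c} \<noteq> {}" by (rule contrapos_nn) (simp only: card.empty)
  then show ?thesis by blast
qed

section \<open>Twisted representations with equal characters\<close>

definition kron :: "'a::times^'n^'n \<Rightarrow> 'a^'n^'n \<Rightarrow> 'a^('n \<times> 'n)^('n \<times> 'n)" where
  "kron A B = (\<chi> i j. A $ fst i $ fst j * B $ snd i $ snd j)"

text \<open>Indexing by pairs turns the operator M \<mapsto> A M B on matrices into the square
  matrix \<open>kron A (transpose B)\<close>, to which the results on eigenvectors and on traces of
  idempotents apply.\<close>

definition vec_of_mat :: "'a^'n^'n \<Rightarrow> 'a^('n \<times> 'n)" where
  "vec_of_mat M = (\<chi> i. M $ fst i $ snd i)"

lemma vec_of_mat_eq_iff [simp]: "vec_of_mat M = vec_of_mat N \<longleftrightarrow> M = N"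
  by (auto simp: vec_of_mat_def vec_eq_iff)

lemma vec_of_mat_surj: "\<exists>M. v = vec_of_mat M"
  by (rule exI[of _ "\<chi> i j. v $ (i, j)"]) (simp add: vec_of_mat_def vec_eq_iff)

lemma vec_of_mat_eq_0_iff [simp]: "vec_of_mat M = 0 \<longleftrightarrow> M = 0"
  by (auto simp: vec_of_mat_def vec_eq_iff)

lemma vec_of_mat_smult: "vec_of_mat (smult_mat c M) = c *s vec_of_mat M"
  by (simp add: vec_of_mat_def vec_eq_iff)

lemma sum_UNIV_prod: "(\<Sum>k\<in>(UNIV :: ('a::finite \<times> 'b::finite) set). f k) = (\<Sum>i\<in>UNIV. \<Sum>j\<in>UNIV. f (i, j))"
  by (simp add: sum.cartesian_product flip: UNIV_Times_UNIV)

lemma kron_mult: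
  "kron A B ** kron C D = kron (A ** C) (B ** (D :: 'a::comm_semiring_1^'n^'n))"
  by (simp add: kron_def vec_eq_iff matrix_matrix_mult_def sum_UNIV_prod sum_product mult_ac)

lemma kron_vec_of_mat:
  "kron A B *v vec_of_mat M = vec_of_mat (A ** M ** transpose (B :: 'a::comm_semiring_1^'n^'n))"
proof -
  have "(\<Sum>i\<in>UNIV. \<Sum>j\<in>UNIV. A $ a $ i * B $ b $ j * M $ i $ j) =
      (\<Sum>j\<in>UNIV. (\<Sum>i\<in>UNIV. A $ a $ i * M $ i $ j) * B $ b $ j)" for a b
    by (subst sum.swap) (simp add: sum_distrib_left sum_distrib_right mult_ac)
  then show ?thesis
    by (simp add: kron_def vec_of_mat_def vec_eq_iff matrix_matrix_mult_def matrix_vector_mult_def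
        transpose_def sum_UNIV_prod)
qed

lemma trace_kron: "trace (kron A B) = trace A * trace (B :: 'a::comm_semiring_1^'n^'n)"
  by (simp add: trace_def kron_def sum_UNIV_prod sum_product)

lemma trace_transpose: "trace (transpose A) = trace A"
  by (simp add: trace_def transpose_def)

lemma kron_smult_mat:
  "kron (smult_mat c A) (smult_mat d B) = smult_mat (c * d) (kron A (B :: 'a::comm_semiring_1^'n^'n))"
  by (simp add: kron_def vec_eq_iff mult_ac)

text \<open>This is what averaging over a finite group draws on: left translations are injective,
  hence permutations of \<open>A\<close>, and the scalars \<open>c\<close> can be inverted. In the
  application \<open>A\<close> is a centralizer, \<open>m\<close> is \<open>psl_mult\<close>, and
  \<open>c\<close> records how the chosen lifts multiply.\<close>

locale finite_cancel_magma =
  fixes A :: "'a set" and m :: "'a \<Rightarrow> 'a \<Rightarrow> 'a" and c :: "'a \<Rightarrow> 'a \<Rightarrow> complex"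
  assumes fin: "finite A" and nonempty: "A \<noteq> {}"
    and closed: "\<And>a b. a \<in> A \<Longrightarrow> b \<in> A \<Longrightarrow> m a b \<in> A"
    and cancel: "\<And>a. a \<in> A \<Longrightarrow> inj_on (m a) A"
    and c_nonzero: "\<And>a b. a \<in> A \<Longrightarrow> b \<in> A \<Longrightarrow> c a b \<noteq> 0"
begin

lemma sum_translate:
  assumes "a \<in> A"
  shows "(\<Sum>b\<in>A. f (m a b)) = (\<Sum>b\<in>A. f b)"
proof -
  have "m a ` A \<subseteq> A" using closed assms by auto
  then have "bij_betw (m a) A A"
    using cancel[OF assms] fin by (simp add: bij_betw_def endo_inj_surj)
  then show ?thesis by (rule sum.reindex_bij_betw)
qed

text \<open>A projective representation with factor set \<open>c\<close>. The inverses are carried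
  along as a second family \<open>x'\<close>, so that rescaled families can name theirs
  directly.\<close>

definition twisted_rep :: "('a \<Rightarrow> complex^'n^'n) \<Rightarrow> ('a \<Rightarrow> complex^'n^'n) \<Rightarrow> bool" where
  "twisted_rep x x' \<longleftrightarrow> (\<forall>a\<in>A. x a ** x' a = mat 1) \<and>
     (\<forall>a\<in>A. \<forall>b\<in>A. x a ** x b = smult_mat (c a b) (x (m a b)))"

lemma
  assumes "twisted_rep x x'" "a \<in> A"
  shows twisted_rep_right_inverse: "x a ** x' a = mat 1"
    and twisted_rep_left_inverse: "x' a ** x a = mat 1"
  using assms by (auto simp: twisted_rep_def) (simp add: matrix_left_right_inverse)

lemma twisted_rep_mult:
  assumes "twisted_rep x x'" "a \<in> A" "b \<in> A"
  shows "x a ** x b = smult_mat (c a b) (x (m a b))"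
  using assms by (auto simp: twisted_rep_def)

lemma twisted_rep_inverse_mult:
  assumes x: "twisted_rep x x'" and ab: "a \<in> A" "b \<in> A"
  shows "x' b ** x' a = smult_mat (inverse (c a b)) (x' (m a b))"
proof -
  note inv = twisted_rep_right_inverse[OF x] twisted_rep_left_inverse[OF x]
  have "x' b ** x' a = x' b ** (x' a ** x a) ** x b ** smult_mat (inverse (c a b)) (x' (m a b))"
  proof -
    have "x a ** x b ** smult_mat (inverse (c a b)) (x' (m a b)) = mat 1"
      using ab c_nonzero[OF ab] inv(1)[of "m a b"] closed[OF ab]
      by (simp add: twisted_rep_mult[OF x] flip: matrix_mul_assoc)
    then have "x' b ** x' a = x' b ** x' a ** (x a ** x b ** smult_mat (inverse (c a b)) (x' (m a b)))"
      by simp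
    then show ?thesis by (simp add: matrix_mul_assoc)
  qed
  then show ?thesis using inv(2) ab by (simp add: matrix_mul_assoc)
qed

text \<open>Since both families have the same factor set, the scalars from \<open>y b ** y a\<close>
  and from \<open>x' a ** x' b\<close> cancel. Multiplying by \<open>y b\<close> on the left and
  \<open>x' b\<close> on the right therefore only permutes the summands.\<close>

lemma conj_avg:
  assumes y: "twisted_rep y y'" and x: "twisted_rep x x'" and b: "b \<in> A"
  shows "y b ** (\<Sum>a\<in>A. y a ** M ** x' a) = (\<Sum>a\<in>A. y a ** M ** x' a) ** x b"
proof -
  have translate: "y b ** (y a ** M ** x' a) ** x' b = y (m b a) ** M ** x' (m b a)" if a: "a \<in> A" for a
  proof -
    have "y b ** (y a ** M ** x' a) ** x' b = (y b ** y a) ** M ** (x' a ** x' b)"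
      by (simp add: matrix_mul_assoc)
    also have "\<dots> = smult_mat (c b a) (y (m b a)) ** M ** smult_mat (inverse (c b a)) (x' (m b a))"
      by (simp only: twisted_rep_mult[OF y b a] twisted_rep_inverse_mult[OF x b a])
    also have "\<dots> = y (m b a) ** M ** x' (m b a)"
      using c_nonzero[OF b a]
      by (simp flip: matrix_mul_assoc)
    finally show ?thesis .
  qed
  have "y b ** (\<Sum>a\<in>A. y a ** M ** x' a) ** x' b = (\<Sum>a\<in>A. y (m b a) ** M ** x' (m b a))"
    unfolding matrix_sum_left matrix_sum_right by (intro sum.cong refl translate)
  also have "\<dots> = (\<Sum>a\<in>A. y a ** M ** x' a)" by (rule sum_translate[OF b])
  finally have "y b ** (\<Sum>a\<in>A. y a ** M ** x' a) ** x' b ** x b = (\<Sum>a\<in>A. y a ** M ** x' a) ** x b"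
    by simp
  then show ?thesis
    using twisted_rep_left_inverse[OF x b] by (simp flip: matrix_mul_assoc)
qed

text \<open>Up to the factor \<open>card A\<close>, the sum is the trace of the projection
  \<open>M \<mapsto> (\<Sum>a. p x(a) M x(a)\<^sup>-\<^sup>1 p) / card A\<close> of the matrix space, which fixes \<open>p\<close>.\<close>
lemma sum_trace_nonzero:
  assumes x: "twisted_rep x x'" and idem: "p ** p = p" and ne: "p \<noteq> 0"
    and comm: "\<And>a. a \<in> A \<Longrightarrow> p ** x a = x a ** p"
  shows "(\<Sum>a\<in>A. trace (p ** x a) * trace (x' a ** p)) \<noteq> 0"
proof -
  define N :: complex where "N = of_nat (card A)"
  have N: "N \<noteq> 0" using fin nonempty by (simp add: N_def)
  \<comment> \<open>\<open>F a\<close> is the operator M \<mapsto> p x(a) M x'(a) p. The scalars of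
    \<open>x\<close> and \<open>x'\<close> cancel in it, so \<open>F\<close> is multiplicative
    without a twist and its average \<open>E\<close> is idempotent.\<close>
  define F where "F a = kron (p ** x a) (transpose (x' a ** p))" for a
  define E where "E = smult_mat (inverse N) (\<Sum>a\<in>A. F a)"
  have comm': "p ** x' a = x' a ** p" if a: "a \<in> A" for a
  proof -
    have "p ** x' a = x' a ** (x a ** p) ** x' a"
      by (simp add: twisted_rep_left_inverse[OF x a] matrix_mul_assoc)
    also have "\<dots> = x' a ** (p ** x a) ** x' a" by (simp only: comm[OF a])
    also have "\<dots> = x' a ** p"
      by (simp add: twisted_rep_right_inverse[OF x a] flip: matrix_mul_assoc)
    finally show ?thesis .
  qed
  have F_mult: "F a ** F b = F (m a b)" if ab: "a \<in> A" "b \<in> A" for a b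
  proof -
    have 1: "p ** x a ** (p ** x b) = smult_mat (c a b) (p ** x (m a b))"
      by (simp add: comm[OF ab(1)] comm[OF ab(2)] comm[OF closed[OF ab]] idem
        comm[OF ab(1), THEN matrix_mult_assoc_cong] comm[OF ab(2), THEN matrix_mult_assoc_cong]
        idem[THEN matrix_mult_assoc_cong]
        twisted_rep_mult[OF x ab, THEN matrix_mult_assoc_cong]
          flip: matrix_mul_assoc)
    have 2: "x' b ** p ** (x' a ** p) = smult_mat (inverse (c a b)) (x' (m a b) ** p)"
      by (simp add: idem comm'[OF ab(1), THEN matrix_mult_assoc_cong]
        twisted_rep_inverse_mult[OF x ab, THEN matrix_mult_assoc_cong]
          flip: matrix_mul_assoc)
    show ?thesis
      using c_nonzero[OF ab]
      by (simp add: F_def kron_mult 1 2 kron_smult_mat flip: matrix_transpose_mul)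
  qed
  have "(\<Sum>a\<in>A. F a) ** (\<Sum>b\<in>A. F b) = (\<Sum>a\<in>A. \<Sum>b\<in>A. F (m a b))"
    unfolding matrix_sum_left unfolding matrix_sum_right by (intro sum.cong refl F_mult)
  also have "\<dots> = (\<Sum>a\<in>A. \<Sum>b\<in>A. F b)"
    by (intro sum.cong refl sum_translate)
  also have "\<dots> = smult_mat N (\<Sum>a\<in>A. F a)"
    by (simp add: vec_eq_iff N_def del: sum_constant) simp
  finally have "E ** E = E"
    using N by (simp add: E_def flip: matrix_mul_assoc)
  moreover have "E \<noteq> 0"
  proof
    have "F a *v vec_of_mat p = vec_of_mat p" if a: "a \<in> A" for a
    proof -
      have "p ** x a ** p ** (x' a ** p) = p"
        by (simp add: comm[OF a, THEN matrix_mult_assoc_cong] comm'[OF a, THEN matrix_mult_assoc_cong]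
          idem twisted_rep_right_inverse[OF x a, THEN matrix_mult_assoc_cong]
            flip: matrix_mul_assoc)
      then show ?thesis by (simp add: F_def kron_vec_of_mat)
    qed
    then have "(\<Sum>a\<in>A. F a) *v vec_of_mat p = N *s vec_of_mat p"
      by (simp add: matrix_vector_sum_left N_def vec_eq_iff cong: sum.cong)
    then have "E *v vec_of_mat p = vec_of_mat p"
      using N by (simp add: E_def flip: matrix_vector_mul_assoc)
    moreover assume "E = 0"
    ultimately show False using ne by (metis matrix_vector_mult_0 vec_of_mat_eq_0_iff)
  qed
  ultimately have "trace E \<noteq> 0" by (rule trace_idempotent_nonzero)
  moreover have "trace E = inverse N * (\<Sum>a\<in>A. trace (p ** x a) * trace (x' a ** p))"
    by (simp add: E_def trace_smult_mat trace_sum F_def trace_kron trace_transpose)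
  ultimately show ?thesis by auto
qed

text \<open>An intertwiner \<open>X\<close> of least nullity has an equivariant generalized inverse \<open>Y\<close>. If
  \<open>p = 1 - Y X\<close> is nonzero, it has the same character as \<open>q = 1 - X Y\<close>, so there is an
  intertwiner \<open>Z = q Z p \<noteq> 0\<close>, and \<open>X + Z\<close> has smaller nullity.\<close>
theorem equal_trace_imp_equivalent:
  fixes x y :: "'a \<Rightarrow> complex^'n^'n"
  assumes x: "twisted_rep x x'" and y: "twisted_rep y y'"
    and tr: "\<And>a. a \<in> A \<Longrightarrow> trace (x a) = trace (y a)"
  shows "\<exists>X. invertible X \<and> (\<forall>a\<in>A. y a ** X = X ** x a)"
proof -
  define intw where "intw X \<longleftrightarrow> (\<forall>a\<in>A. y a ** X = X ** x a)" for X
  define ker where "ker X = {v. X *v v = 0}" for X :: "complex^'n^'n"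
  have sub_ker: "vec.subspace (ker X)" for X
    by (auto simp: ker_def vec.subspace_def vec.add vec.scale)
  have "intw 0" by (simp add: intw_def)
  then obtain X where X: "intw X" and least: "\<And>Y. intw Y \<Longrightarrow> vec.dim (ker X) \<le> vec.dim (ker Y)"
    using exists_least_iff[of "\<lambda>d. \<exists>X. vec.dim (ker X) = d \<and> intw X"] by (metis not_le_imp_less)
  have Xx: "y a ** X = X ** x a" if "a \<in> A" for a using X that by (simp add: intw_def)
  note xi = twisted_rep_right_inverse[OF x] twisted_rep_left_inverse[OF x]
  note yi = twisted_rep_right_inverse[OF y] twisted_rep_left_inverse[OF y]
  have Xx': "y' a ** X = X ** x' a" if a: "a \<in> A" for a
  proof -
    have "y' a ** X = y' a ** (X ** x a) ** x' a"
      by (simp add: xi(1)[OF a] flip: matrix_mul_assoc)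
    also have "\<dots> = y' a ** (y a ** X) ** x' a" by (simp only: Xx[OF a])
    also have "\<dots> = X ** x' a" by (simp add: yi(2)[OF a] matrix_mul_assoc)
    finally show ?thesis .
  qed
  obtain Y0 where Y0: "X ** Y0 ** X = X" using exists_generalized_inverse by blast
  define N :: complex where "N = of_nat (card A)"
  have N: "N \<noteq> 0" using fin nonempty by (simp add: N_def)
  \<comment> \<open>Averaging makes the generalized inverse an intertwiner in the opposite
    direction. The equation \<open>X ** Y ** X = X\<close> is kept, since \<open>X\<close>
    intertwines both the families and their inverses and so every summand satisfies it.\<close>
  define Y where "Y = smult_mat (inverse N) (\<Sum>a\<in>A. x a ** Y0 ** y' a)"
  have Yy: "x a ** Y = Y ** y a" if "a \<in> A" for a
    using conj_avg[OF x y that, of Y0] by (simp add: Y_def flip: matrix_mul_assoc)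
  have "X ** (x a ** Y0 ** y' a) ** X = X" if a: "a \<in> A" for a
  proof -
    have "X ** (x a ** Y0 ** y' a) ** X = (X ** x a) ** Y0 ** (y' a ** X)"
      by (simp add: matrix_mul_assoc)
    also have "\<dots> = (y a ** X) ** Y0 ** (X ** x' a)" by (simp only: Xx[OF a] Xx'[OF a])
    also have "\<dots> = y a ** (X ** Y0 ** X) ** x' a" by (simp add: matrix_mul_assoc)
    also have "\<dots> = X ** (x a ** x' a)" by (simp only: Y0 Xx[OF a] matrix_mul_assoc)
    also have "\<dots> = X" by (simp add: xi(1)[OF a])
    finally show ?thesis .
  qed
  then have "X ** (\<Sum>a\<in>A. x a ** Y0 ** y' a) ** X = smult_mat N X"
    using fin by (simp add: matrix_sum_left matrix_sum_right N_def vec_eq_iff)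
  then have XYX: "X ** Y ** X = X"
    using N by (simp add: Y_def flip: matrix_mul_assoc)
  \<comment> \<open>\<open>p\<close> projects onto the kernel of \<open>X\<close>, and
    \<open>q\<close> onto a complement of its range. Both commute with the respective action, and
    \<open>p = 0\<close> means that \<open>X\<close> is invertible.\<close>
  define p where "p = mat 1 - Y ** X"
  define q where "q = mat 1 - X ** Y"
  have YXYX: "Y ** X ** (Y ** X) = Y ** X" using XYX by (simp flip: matrix_mul_assoc)
  have XYXY: "X ** Y ** (X ** Y) = X ** Y" using XYX by (simp add: matrix_mul_assoc)
  have pp: "p ** p = p" by (simp add: p_def matrix_diff_ldistrib matrix_diff_rdistrib YXYX)
  have XYq: "X ** Y ** q = 0" by (simp add: q_def matrix_diff_ldistrib XYXY)
  have Xp: "X ** p = 0" using XYX by (simp add: p_def matrix_diff_ldistrib matrix_mul_assoc)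
  have px: "p ** x a = x a ** p" if a: "a \<in> A" for a
  proof -
    have "Y ** X ** x a = Y ** y a ** X" by (simp add: Xx[OF a] flip: matrix_mul_assoc)
    also have "\<dots> = x a ** (Y ** X)" by (simp add: matrix_mul_assoc flip: Yy[OF a])
    finally show ?thesis by (simp add: p_def matrix_diff_ldistrib matrix_diff_rdistrib)
  qed
  have qy: "q ** y a = y a ** q" if a: "a \<in> A" for a
  proof -
    have "X ** Y ** y a = X ** x a ** Y" by (simp add: Yy[OF a] flip: matrix_mul_assoc)
    also have "\<dots> = y a ** (X ** Y)" by (simp add: matrix_mul_assoc flip: Xx[OF a])
    finally show ?thesis by (simp add: q_def matrix_diff_ldistrib matrix_diff_rdistrib)
  qed
  \<comment> \<open>Cyclicity of the trace gives \<open>Y ** X\<close> and \<open>X ** Y\<close> the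
    same character; subtracting it from the equal characters of \<open>x\<close> and
    \<open>y\<close> leaves equal ones for \<open>p\<close> and \<open>q\<close>.\<close>
  have tr_pq: "trace (q ** y a) = trace (p ** x a)" if a: "a \<in> A" for a
  proof -
    have "trace (X ** Y ** y a) = trace (X ** (x a ** Y))"
      by (simp add: Yy[OF a] flip: matrix_mul_assoc)
    also have "\<dots> = trace (Y ** X ** x a)"
      by (simp add: trace_mul_sym[of "X ** x a"] matrix_mul_assoc)
    finally show ?thesis
      by (simp add: p_def q_def matrix_diff_rdistrib trace_sub tr[OF a])
  qed
  have "p = 0"
  proof (rule ccontr)
    assume "p \<noteq> 0"
    \<comment> \<open>Matrix units extract a product of traces: the (i,j) entry of
      \<open>Z (e i j)\<close>, summed over all i and j, is the sum over \<open>a\<close> of trace(q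
      y(a)) trace(x'(a) p). With \<open>tr_pq\<close> this is the nonzero sum of
      \<open>sum_trace_nonzero\<close>, so some \<open>Z (e i j)\<close> is nonzero.\<close>
    define e :: "'n \<Rightarrow> 'n \<Rightarrow> complex^'n^'n"
      where "e i j = (\<chi> k l. if k = i \<and> l = j then 1 else 0)" for i j
    define Z where "Z M = q ** (\<Sum>a\<in>A. y a ** M ** x' a) ** p" for M
    have Z_sum: "Z M = (\<Sum>a\<in>A. q ** y a ** M ** (x' a ** p))" for M
      by (simp add: Z_def matrix_sum_left matrix_sum_right matrix_mul_assoc)
    have e_entry: "(B ** e i j ** C) $ k $ l = B $ k $ i * C $ j $ l" for B C i j k l
    proof -
      have Be: "(B ** e i j) $ k $ s = (if s = j then B $ k $ i else 0)" for s
        unfolding matrix_matrix_mult_def e_def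
        by (cases "s = j") (simp_all add: if_distrib cong: if_cong)
      show ?thesis
        unfolding matrix_matrix_mult_def[of "B ** e i j"]
        by (simp add: Be if_distribR if_distrib cong: if_cong)
    qed
    have "(\<Sum>i\<in>UNIV. \<Sum>j\<in>UNIV. Z (e i j) $ i $ j) =
        (\<Sum>i\<in>UNIV. \<Sum>j\<in>UNIV. \<Sum>a\<in>A. (q ** y a) $ i $ i * (x' a ** p) $ j $ j)"
      by (simp add: Z_sum e_entry)
    also have "\<dots> = (\<Sum>a\<in>A. \<Sum>i\<in>UNIV. \<Sum>j\<in>UNIV. (q ** y a) $ i $ i * (x' a ** p) $ j $ j)"
      by (simp only: sum.swap[of _ A UNIV])
    also have "\<dots> = (\<Sum>a\<in>A. trace (p ** x a) * trace (x' a ** p))"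
      by (simp add: tr_pq[symmetric] cong: sum.cong) (simp add: trace_def sum_product)
    also have "\<dots> \<noteq> 0" using sum_trace_nonzero[OF x pp \<open>p \<noteq> 0\<close> px] .
    finally have sum0: "(\<Sum>i\<in>UNIV. \<Sum>j\<in>UNIV. Z (e i j) $ i $ j) \<noteq> 0" .
    have "\<exists>M. Z M \<noteq> 0"
    proof (rule ccontr)
      assume "\<nexists>M. Z M \<noteq> 0"
      then show False using sum0 by simp
    qed
    then obtain M where M: "Z M \<noteq> 0" by blast
    have "y a ** Z M = Z M ** x a" if a: "a \<in> A" for a
    proof -
      let ?S = "\<Sum>a\<in>A. y a ** M ** x' a"
      have "y a ** Z M = (q ** y a) ** ?S ** p" by (simp add: Z_def qy[OF a] matrix_mul_assoc)
      also have "\<dots> = q ** (y a ** ?S) ** p" by (simp add: matrix_mul_assoc)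
      also have "\<dots> = q ** ?S ** (x a ** p)" by (simp add: conj_avg[OF y x a] matrix_mul_assoc)
      also have "\<dots> = Z M ** x a" by (simp add: Z_def matrix_mul_assoc flip: px[OF a])
      finally show ?thesis .
    qed
    then have "intw (X + Z M)"
      by (simp add: intw_def Xx matrix_add_ldistrib matrix_add_rdistrib)
    have XYZ: "X ** Y ** Z M = 0" by (simp add: Z_def matrix_mul_assoc XYq)
    have Zp: "Z M ** p = Z M" by (simp add: Z_def pp flip: matrix_mul_assoc)
    \<comment> \<open>\<open>X ** Y\<close> annihilates \<open>Z M\<close> and fixes
      \<open>X\<close>, so a vector killed by \<open>X + Z M\<close> is killed by \<open>X\<close>.
      Minimality then forces the two kernels to be equal, but \<open>p *v u\<close> lies only in the
      kernel of \<open>X\<close>.\<close>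
    have "ker (X + Z M) \<subseteq> ker X"
    proof
      fix w assume "w \<in> ker (X + Z M)"
      then have "(X ** Y ** (X + Z M)) *v w = 0"
        by (simp add: ker_def flip: matrix_vector_mul_assoc)
      then show "w \<in> ker X"
        by (simp add: ker_def matrix_add_ldistrib XYX XYZ)
    qed
    then have "ker (X + Z M) = ker X"
      by (intro vec.subspace_dim_equal sub_ker least \<open>intw (X + Z M)\<close>)
    obtain u where u: "Z M *v u \<noteq> 0" using M matrix_eq[of "Z M" 0] by auto
    have "p *v u \<in> ker X" by (simp add: ker_def matrix_vector_mul_assoc Xp)
    moreover have "p *v u \<notin> ker (X + Z M)"
      using u by (simp add: ker_def matrix_vector_mul_assoc matrix_add_rdistrib Xp Zp)
    ultimately show False using \<open>ker (X + Z M) = ker X\<close> by blast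
  qed
  then have "invertible X" by (auto simp: p_def invertible_left_inverse)
  with Xx show ?thesis by blast
qed

end

section \<open>From equal commutator scalars to equal factor sets\<close>

lemma inverse_mult_swap:
  fixes A B :: "'a::field^'n^'n"
  assumes "A ** A' = mat 1" "B ** B' = mat 1" and AB: "A ** B = smult_mat e (B ** A)"
  shows "A' ** B' = smult_mat e (B' ** A')"
proof -
  have inv: "A ** A' = mat 1" "A' ** A = mat 1" "B ** B' = mat 1" "B' ** B = mat 1"
    using assms by (simp_all add: matrix_left_right_inverse)
  \<comment> \<open>Cancelling factors are inserted so that \<open>A ** B\<close> occurs and can be
    swapped; inverting both factors leaves the commutator scalar unchanged.\<close>
  have "A' ** B' = B' ** (A' ** (A ** B)) ** (A' ** B')"
    by (simp add: inv inv[THEN matrix_mult_assoc_cong] flip: matrix_mul_assoc)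
  also have "\<dots> = smult_mat e (B' ** (A' ** (B ** A)) ** (A' ** B'))" by (simp add: AB)
  also have "\<dots> = smult_mat e (B' ** A')"
    by (simp add: inv inv[THEN matrix_mult_assoc_cong] flip: matrix_mul_assoc)
  finally show ?thesis .
qed

text \<open>The operators \<open>M \<mapsto> y(a) M x(a)\<^sup>-\<^sup>1\<close> commute since the commutator scalars cancel. A common
  eigenvector \<open>M\<close>, with eigenvalues \<open>\<mu>\<close>, shows that \<open>y/\<mu>\<close> has the same factor set as \<open>x\<close>; it need not
  itself be invertible.\<close>
theorem (in finite_cancel_magma) equal_commutator_imp_equivalent:
  fixes x y x' y' :: "'a \<Rightarrow> complex^'n^'n"
  assumes x: "twisted_rep x x'"
    and y_inv: "\<And>a. a \<in> A \<Longrightarrow> y a ** y' a = mat 1"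
    and y_mult: "\<And>a b. a \<in> A \<Longrightarrow> b \<in> A \<Longrightarrow> y a ** y b = smult_mat (d a b) (y (m a b))"
    and x_comm: "\<And>a b. a \<in> A \<Longrightarrow> b \<in> A \<Longrightarrow> x a ** x b = smult_mat (e a b) (x b ** x a)"
    and y_comm: "\<And>a b. a \<in> A \<Longrightarrow> b \<in> A \<Longrightarrow> y a ** y b = smult_mat (e a b) (y b ** y a)"
    and e_nonzero: "\<And>a b. a \<in> A \<Longrightarrow> b \<in> A \<Longrightarrow> e a b \<noteq> 0"
    and tr: "\<And>a. a \<in> A \<Longrightarrow> (trace (x a) = 0 \<and> trace (y a) = 0) \<or>
      (\<exists>s t. x a = mat s \<and> y a = mat t)"
  shows "\<exists>X \<mu>. invertible X \<and> (\<forall>a\<in>A. y a ** X = smult_mat (\<mu> a) (X ** x a))"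
proof -
  note xi = twisted_rep_right_inverse[OF x] twisted_rep_left_inverse[OF x]
  have y_inv': "y' a ** y a = mat 1" if "a \<in> A" for a
    using y_inv[OF that] by (simp add: matrix_left_right_inverse)
  define T where "T a = kron (y a) (transpose (x' a))" for a
  have "T a ** T b = T b ** T a" if ab: "a \<in> A" "b \<in> A" for a b
  proof -
    have "x' a ** x' b = smult_mat (e a b) (x' b ** x' a)"
      by (rule inverse_mult_swap[OF xi(1) xi(1) x_comm]) fact+
    then have "x' b ** x' a = smult_mat (inverse (e a b)) (x' a ** x' b)"
      using e_nonzero[OF ab] by simp
    then show ?thesis
      using e_nonzero[OF ab]
      by (simp add: T_def kron_mult y_comm[OF ab] kron_smult_mat flip: matrix_transpose_mul)
  qed
  from commuting_common_eigenvector[of A T, OF this] obtain v \<mu>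
    where v: "v \<noteq> 0" "\<And>a. a \<in> A \<Longrightarrow> T a *v v = \<mu> a *s v" by blast
  obtain M where M: "v = vec_of_mat M" using vec_of_mat_surj by blast
  have M0: "M \<noteq> 0" using v(1) M by simp
  have yM: "y a ** M = smult_mat (\<mu> a) (M ** x a)" if a: "a \<in> A" for a
  proof -
    have "y a ** M ** x' a = smult_mat (\<mu> a) M"
      using v(2)[OF a] by (simp add: M T_def kron_vec_of_mat flip: vec_of_mat_smult)
    then have "y a ** M ** x' a ** x a = smult_mat (\<mu> a) (M ** x a)"
      by (simp only: smult_mat_mult_left)
    then show ?thesis using xi(2)[OF a] by (simp flip: matrix_mul_assoc)
  qed
  have Mx0: "M ** x a \<noteq> 0" if a: "a \<in> A" for a
  proof
    assume "M ** x a = 0"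
    then have "M ** x a ** x' a = 0" by simp
    then show False using M0 xi(1)[OF a] by (simp flip: matrix_mul_assoc)
  qed
  have mu0: "\<mu> a \<noteq> 0" if a: "a \<in> A" for a
  proof
    assume "\<mu> a = 0"
    then have "y' a ** (y a ** M) = 0" by (simp add: yM[OF a])
    then show False using M0 y_inv'[OF a] by (simp add: matrix_mul_assoc)
  qed
  have smult_cancel: "s = t" if "smult_mat s C = smult_mat t C" "C \<noteq> 0" for s t :: complex and C :: "complex^'n^'n"
    using that by (auto simp: vec_eq_iff)
  define y2 where "y2 a = smult_mat (inverse (\<mu> a)) (y a)" for a
  have y2M: "y2 a ** M = M ** x a" if a: "a \<in> A" for a
    using mu0[OF a] by (simp add: y2_def yM[OF a])
  have y: "twisted_rep y2 (\<lambda>a. smult_mat (\<mu> a) (y' a))"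
    unfolding twisted_rep_def
  proof safe
    fix a assume a: "a \<in> A"
    show "y2 a ** smult_mat (\<mu> a) (y' a) = mat 1"
      using mu0[OF a] y_inv[OF a] by (simp add: y2_def)
  next
    fix a b assume ab: "a \<in> A" "b \<in> A"
    note ab' = closed[OF ab]
    \<comment> \<open>\<open>\<delta>\<close> is the factor set of \<open>y2\<close>. Applied to
      \<open>M\<close>, the products of \<open>y2\<close> turn into products of \<open>x\<close> on
      the right, and \<open>M ** x (m a b)\<close> is nonzero because \<open>x (m a b)\<close> is
      invertible; comparing coefficients gives \<open>\<delta> = c a b\<close>.\<close>
    define \<delta> where "\<delta> = inverse (\<mu> a) * inverse (\<mu> b) * d a b * \<mu> (m a b)"
    have mult: "y2 a ** y2 b = smult_mat \<delta> (y2 (m a b))"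
      using mu0[OF ab'] by (simp add: y2_def y_mult[OF ab] \<delta>_def mult_ac)
    have "smult_mat \<delta> (M ** x (m a b)) = y2 a ** y2 b ** M"
      by (simp add: mult y2M[OF ab'])
    also have "\<dots> = y2 a ** M ** x b" by (simp add: y2M[OF ab(2)] flip: matrix_mul_assoc)
    also have "\<dots> = M ** (x a ** x b)" by (simp add: y2M[OF ab(1)] flip: matrix_mul_assoc)
    also have "\<dots> = smult_mat (c a b) (M ** x (m a b))" by (simp add: twisted_rep_mult[OF x ab])
    finally have "\<delta> = c a b" by (rule smult_cancel) (rule Mx0[OF ab'])
    with mult show "y2 a ** y2 b = smult_mat (c a b) (y2 (m a b))" by simp
  qed
  \<comment> \<open>Trace 0 survives rescaling. Where both matrices are scalar,
    \<open>y2 a ** M = M ** x a\<close> with \<open>M\<close> nonzero makes them equal.\<close>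
  have "trace (x a) = trace (y2 a)" if a: "a \<in> A" for a
    using tr[OF a]
  proof (elim disjE exE conjE)
    fix s t assume st: "x a = mat s" "y a = mat t"
    have "smult_mat (inverse (\<mu> a) * t) M = smult_mat s M"
      using y2M[OF a] by (simp add: y2_def st mat_eq_smult[of s] mat_eq_smult[of t])
    then have "inverse (\<mu> a) * t = s" by (rule smult_cancel) (rule M0)
    then have "y2 a = x a" by (simp add: y2_def st mat_eq_smult[of s] mat_eq_smult[of t])
    then show ?thesis by simp
  qed (simp add: y2_def trace_smult_mat)
  from equal_trace_imp_equivalent[OF x y this] obtain X
    where X: "invertible X" "\<And>a. a \<in> A \<Longrightarrow> y2 a ** X = X ** x a" by blast
  have "y a ** X = smult_mat (\<mu> a) (X ** x a)" if a: "a \<in> A" for a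
    using mu0[OF a] by (simp add: y2_def flip: X(2)[OF a])
  with X(1) show ?thesis by blast
qed

section \<open>The group PSL(n, C) and its centralizers\<close>

lemma matrix_inv_eqI:
  fixes A B :: "'a::field^'n^'n"
  assumes "A ** B = mat 1"
  shows "matrix_inv A = B"
proof -
  have BA: "B ** A = mat 1" using assms by (simp add: matrix_left_right_inverse)
  have "A ** matrix_inv A = mat 1 \<and> matrix_inv A ** A = mat 1"
    unfolding matrix_inv_def by (rule someI[of _ B]) (simp add: assms BA)
  then have "matrix_inv A = B ** A ** matrix_inv A" "A ** matrix_inv A = mat 1"
    by (simp_all add: BA)
  then show ?thesis by (simp flip: matrix_mul_assoc)
qed

lemma SL_inverse:
  assumes "A \<in> SL"
  shows SL_right_inverse: "A ** matrix_inv A = mat 1"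
    and SL_left_inverse: "matrix_inv A ** A = mat 1"
    and SL_matrix_inv: "matrix_inv A \<in> SL"
proof -
  have "invertible A" using assms by (simp add: SL_def invertible_det_nz)
  then obtain B where B: "A ** B = mat 1" by (auto simp: invertible_right_inverse)
  then show 1: "A ** matrix_inv A = mat 1" by (simp add: matrix_inv_eqI[OF B])
  then show "matrix_inv A ** A = mat 1" by (simp add: matrix_left_right_inverse)
  have "det A * det (matrix_inv A) = 1" using 1 det_mul[of A "matrix_inv A"] by simp
  then show "matrix_inv A \<in> SL" using assms by (simp add: SL_def)
qed

lemma SL_mult: "A \<in> SL \<Longrightarrow> B \<in> SL \<Longrightarrow> A ** B \<in> SL"
  by (simp add: SL_def det_mul)

lemma mat_1_SL: "mat 1 \<in> SL" by (simp add: SL_def)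

lemma smult_SL: "z ^ CARD('n) = 1 \<Longrightarrow> A \<in> SL \<Longrightarrow> smult_mat z A \<in> (SL :: ('n::finite) cmat set)"
  by (simp add: SL_def det_smult_mat)

lemma SL_nonzero: "A \<in> SL \<Longrightarrow> A \<noteq> 0"
  using det_smult_mat[of 0 A] by (auto simp: SL_def zero_power)

lemma smult_mat_cancel:
  "C \<noteq> 0 \<Longrightarrow> smult_mat s C = smult_mat t C \<longleftrightarrow> s = (t :: 'a::idom)"
  by (auto simp: vec_eq_iff)

lemma roots_unity_bij:
  "bij_betw (\<lambda>k. cis (2 * pi * real k / real CARD('n::finite))) {..<CARD('n)} {z. z ^ CARD('n) = 1}"
  by (rule Complex.bij_betw_roots_unity) simp

lemma pi_n_eq: "pi_n (A :: ('n::finite) cmat) = {smult_mat z A |z. z ^ CARD('n) = 1}"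
proof -
  have "cis (2 * pi * real k / real CARD('n)) ^ CARD('n) = 1" for k
    using cis_multiple_2pi[of "real k"] by (simp add: Complex.DeMoivre)
  moreover have "\<exists>k. z = cis (2 * pi * real k / real CARD('n))" if "z ^ CARD('n) = 1" for z
    using that roots_unity_bij[where 'n='n] by (auto simp: bij_betw_def set_eq_iff image_iff)
  ultimately show ?thesis
    by (auto simp: pi_n_def root_scalar_def mat_mult_eq_smult)
qed

lemma pi_n_self: "A \<in> pi_n A"
  by (auto simp: pi_n_eq intro!: exI[of _ 1])

lemma pi_n_eq_iff:
  fixes A B :: "('n::finite) cmat"
  shows "pi_n A = pi_n B \<longleftrightarrow> (\<exists>z. z ^ CARD('n) = 1 \<and> A = smult_mat z B)"
proof
  assume "pi_n A = pi_n B"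
  then have "A \<in> pi_n B" using pi_n_self by blast
  then show "\<exists>z. z ^ CARD('n) = 1 \<and> A = smult_mat z B" by (auto simp: pi_n_eq)
next
  assume "\<exists>z. z ^ CARD('n) = 1 \<and> A = smult_mat z B"
  then obtain z where z: "z ^ CARD('n) = 1" "A = smult_mat z B" by blast
  have "z \<noteq> 0" using z(1) by (auto simp: zero_power)
  have "\<exists>v. smult_mat w B = smult_mat (v * z) B \<and> v ^ CARD('n) = 1" if "w ^ CARD('n) = 1" for w
    using that z(1) \<open>z \<noteq> 0\<close> by (intro exI[of _ "w / z"]) (simp add: power_divide)
  moreover have "(v * z) ^ CARD('n) = 1" if "v ^ CARD('n) = 1" for v
    using that z(1) by (simp add: power_mult_distrib)
  ultimately show "pi_n A = pi_n B" by (auto simp: pi_n_eq z(2))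
qed

lemma pi_n_eqI: "A \<in> pi_n B \<Longrightarrow> pi_n A = pi_n B"
  unfolding pi_n_eq_iff by (auto simp: pi_n_eq)

lemma PSL_eq_pi_n: "a \<in> PSL \<Longrightarrow> A \<in> a \<Longrightarrow> a = pi_n A"
  by (auto simp: PSL_def dest: pi_n_eqI)

lemma PSL_lift_SL: "a \<in> PSL \<Longrightarrow> A \<in> a \<Longrightarrow> A \<in> SL"
  by (auto simp: PSL_def pi_n_eq smult_SL)

lemma pi_n_PSL: "A \<in> SL \<Longrightarrow> pi_n A \<in> PSL"
  by (simp add: PSL_def)

lemma PSL_nonempty: "a \<in> PSL \<Longrightarrow> \<exists>A. A \<in> a"
  using pi_n_self by (auto simp: PSL_def)

lemma psl_mult_pi_n: "psl_mult (pi_n A) (pi_n B) = pi_n (A ** (B :: ('n::finite) cmat))"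
proof (intro equalityI subsetI)
  fix C assume "C \<in> psl_mult (pi_n A) (pi_n B)"
  then obtain v w where "C = smult_mat (v * w) (A ** B)" "v ^ CARD('n) = 1" "w ^ CARD('n) = 1"
    by (auto simp: psl_mult_def pi_n_eq mult.commute)
  then show "C \<in> pi_n (A ** B)"
    by (auto simp: pi_n_eq power_mult_distrib intro!: exI[of _ "v * w"])
next
  fix C assume "C \<in> pi_n (A ** B)"
  then obtain z where "C = smult_mat z A ** B" "z ^ CARD('n) = 1"
    by (auto simp: pi_n_eq)
  then show "C \<in> psl_mult (pi_n A) (pi_n B)"
    using pi_n_self[of B] unfolding psl_mult_def pi_n_eq[of A] by blast
qed

lemma psl_inv_pi_n:
  fixes A :: "('n::finite) cmat"
  assumes "A \<in> SL"
  shows "psl_inv (pi_n A) = pi_n (matrix_inv A)"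
proof -
  have inv: "matrix_inv (smult_mat z A) = smult_mat (inverse z) (matrix_inv A)"
    if "z ^ CARD('n) = 1" for z
  proof -
    have "z \<noteq> 0" using that by (auto simp: zero_power)
    then show ?thesis by (intro matrix_inv_eqI) (simp add: SL_right_inverse[OF assms])
  qed
  show ?thesis
  proof (intro equalityI subsetI)
    fix B assume "B \<in> psl_inv (pi_n A)"
    then obtain z where "z ^ CARD('n) = 1" "B = smult_mat (inverse z) (matrix_inv A)"
      by (auto simp: psl_inv_def pi_n_eq inv)
    then show "B \<in> pi_n (matrix_inv A)"
      by (auto simp: pi_n_eq power_inverse intro!: exI[of _ "inverse z"])
  next
    fix B assume "B \<in> pi_n (matrix_inv A)"
    then obtain z where z: "z ^ CARD('n) = 1" "B = smult_mat z (matrix_inv A)"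
      by (auto simp: pi_n_eq)
    have w: "inverse z ^ CARD('n) = 1" using z(1) by (simp add: power_inverse)
    have "B = matrix_inv (smult_mat (inverse z) A)" using inv[OF w] z(2) by simp
    then show "B \<in> psl_inv (pi_n A)" using w by (auto simp: psl_inv_def pi_n_eq)
  qed
qed

text \<open>An eigenspace of \<open>A\<close> is nonzero and invariant under \<open>S\<close>, hence
  the whole space.\<close>

lemma schur:
  assumes irr: "irreducible_SL S" and comm: "\<And>h. h \<in> S \<Longrightarrow> A ** h = h ** A"
  shows "\<exists>c. A = mat c"
proof -
  have "(1 :: complex^'a) \<noteq> 0" by (simp add: vec_eq_iff)
  then obtain c v where cv: "v \<noteq> 0" "A *v v = c *s v"
    using eigenvector_in_subspace[OF vec.subspace_UNIV, of A 1] by auto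
  define V where "V = {v. A *v v = c *s v}"
  have "csubspace V"
    by (auto simp: V_def csubspace_def vec.add vec.scale vec.scale_right_distrib mult.commute)
  moreover have "h *v v \<in> V" if "h \<in> S" "v \<in> V" for h v
  proof -
    have "A *v (h *v v) = h *v (A *v v)" by (simp add: matrix_vector_mul_assoc comm[OF that(1)])
    then show ?thesis using that(2) by (simp add: V_def vec.scale)
  qed
  moreover have "V \<noteq> {0}" using cv by (auto simp: V_def)
  ultimately have "V = UNIV" using irr unfolding irreducible_SL_def by blast
  then have "A *v v = mat c *v v" for v by (auto simp: V_def mat_eq_smult[of c])
  then show ?thesis using matrix_eq by blast
qed

lemma matrix_inv_scalar_commute:
  assumes X: "X \<in> SL" "v \<noteq> 0" "X ** h = smult_mat v (h ** X)"
  shows "matrix_inv X ** h = smult_mat (inverse v) (h ** matrix_inv X)"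
proof -
  have "h ** matrix_inv X = matrix_inv X ** (X ** h) ** matrix_inv X"
    using SL_left_inverse[OF X(1)] by (simp add: matrix_mul_assoc)
  also have "\<dots> = smult_mat v (matrix_inv X ** h ** (X ** matrix_inv X))"
    by (simp add: X(3)) (simp add: matrix_mul_assoc)
  finally have "h ** matrix_inv X = smult_mat v (matrix_inv X ** h)"
    using SL_right_inverse[OF X(1)] by simp
  then show ?thesis using X(2) by simp
qed

lemma psl_mult_commute_iff:
  fixes A B :: "('n::finite) cmat"
  shows "psl_mult (pi_n A) (pi_n B) = psl_mult (pi_n B) (pi_n A) \<longleftrightarrow>
    (\<exists>z. z ^ CARD('n) = 1 \<and> A ** B = smult_mat z (B ** A))"
  by (simp add: psl_mult_pi_n pi_n_eq_iff)

section \<open>The centralizer of an irreducible subgroup\<close>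

locale irreducible_psl_subgroup =
  fixes H :: "('n::finite) cmat set set"
  assumes subgroup: "psl_subgroup H" and irreducible: "irreducible_PSL H"
begin

abbreviation "Z \<equiv> psl_centralizer H"

lemma Z_PSL: "a \<in> Z \<Longrightarrow> a \<in> PSL"
  by (simp add: psl_centralizer_def)

lemma Z_lift: "a \<in> Z \<Longrightarrow> A \<in> a \<Longrightarrow> A \<in> SL \<and> a = pi_n A"
  using Z_PSL PSL_lift_SL PSL_eq_pi_n by blast

lemma pi_n_in_Z_iff:
  "pi_n A \<in> Z \<longleftrightarrow> pi_n A \<in> PSL \<and> (\<forall>h\<in>\<Union>H. \<exists>z. z ^ CARD('n) = 1 \<and> A ** h = smult_mat z (h ** A))"
proof -
  have H: "h \<in> PSL" if "h \<in> H" for h using that subgroup by (auto simp: psl_subgroup_def)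
  have "(\<forall>h\<in>H. psl_mult (pi_n A) h = psl_mult h (pi_n A)) \<longleftrightarrow>
      (\<forall>h\<in>\<Union>H. psl_mult (pi_n A) (pi_n h) = psl_mult (pi_n h) (pi_n A))"
    using PSL_nonempty[OF H] PSL_eq_pi_n[OF H] by (metis UnionE UnionI)
  then show ?thesis by (simp add: psl_centralizer_def psl_mult_commute_iff)
qed

lemma pi_n_1_in_Z: "pi_n (mat 1) \<in> Z"
  by (auto simp: pi_n_in_Z_iff pi_n_PSL mat_1_SL intro!: exI[of _ 1])

lemma Z_closed:
  assumes "a \<in> Z" "b \<in> Z"
  shows "psl_mult a b \<in> Z"
proof -
  obtain A B where AB: "A \<in> a" "B \<in> b" using assms Z_PSL PSL_nonempty by meson
  have A: "A \<in> SL" "a = pi_n A" and B: "B \<in> SL" "b = pi_n B"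
    using assms AB Z_lift by blast+
  have "\<exists>z. z ^ CARD('n) = 1 \<and> A ** B ** h = smult_mat z (h ** (A ** B))" if h: "h \<in> \<Union>H" for h
  proof -
    obtain v where v: "v ^ CARD('n) = 1" "A ** h = smult_mat v (h ** A)"
      using assms(1) h unfolding A(2) pi_n_in_Z_iff by blast
    obtain w where w: "w ^ CARD('n) = 1" "B ** h = smult_mat w (h ** B)"
      using assms(2) h unfolding B(2) pi_n_in_Z_iff by blast
    have "A ** B ** h = smult_mat w (A ** h ** B)" by (simp add: w(2) flip: matrix_mul_assoc)
    also have "\<dots> = smult_mat (v * w) (h ** (A ** B))"
      by (simp add: v(2) mult.commute) (simp add: matrix_mul_assoc)
    finally show ?thesis
      using v(1) w(1) by (intro exI[of _ "v * w"]) (simp add: power_mult_distrib)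
  qed
  then show ?thesis
    unfolding A(2) B(2) psl_mult_pi_n pi_n_in_Z_iff using A(1) B(1) pi_n_PSL SL_mult by blast
qed

lemma Z_inverse:
  assumes "a \<in> Z" "A \<in> a"
  shows "pi_n (matrix_inv A) \<in> Z"
proof -
  have A: "A \<in> SL" "a = pi_n A" using assms Z_lift by blast+
  have "\<exists>z. z ^ CARD('n) = 1 \<and> matrix_inv A ** h = smult_mat z (h ** matrix_inv A)"
    if h: "h \<in> \<Union>H" for h
  proof -
    obtain v where v: "v ^ CARD('n) = 1" "A ** h = smult_mat v (h ** A)"
      using assms(1) h unfolding A(2) pi_n_in_Z_iff by blast
    have "v \<noteq> 0" using v(1) by (auto simp: zero_power)
    from matrix_inv_scalar_commute[OF A(1) this v(2)] v(1) show ?thesis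
      by (intro exI[of _ "inverse v"]) (simp add: power_inverse)
  qed
  then show ?thesis unfolding pi_n_in_Z_iff using A(1) SL_matrix_inv pi_n_PSL by blast
qed

text \<open>\<open>A\<close> and \<open>B\<close> commute with each \<open>h\<close> up to scalars,
  and their inverses up to the inverse scalars. All of these cancel in the commutator
  \<open>C\<close>, so Schur's lemma makes \<open>C\<close> scalar; determinant 1 makes that scalar
  an n-th root of unity.\<close>

lemma commutator_scalar:
  assumes "a \<in> Z" "b \<in> Z" "A \<in> a" "B \<in> b"
  shows "\<exists>z. z ^ CARD('n) = 1 \<and> A ** B = smult_mat z (B ** A)"
proof -
  have A: "A \<in> SL" "a = pi_n A" and B: "B \<in> SL" "b = pi_n B"
    using assms Z_lift by blast+
  note Ai = SL_inverse[OF A(1)] and Bi = SL_inverse[OF B(1)]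
  define C where "C = A ** B ** matrix_inv A ** matrix_inv B"
  have "C ** h = h ** C" if h: "h \<in> \<Union>H" for h
  proof -
    obtain v where v: "v ^ CARD('n) = 1" "A ** h = smult_mat v (h ** A)"
      using assms(1) h unfolding A(2) pi_n_in_Z_iff by blast
    obtain w where w: "w ^ CARD('n) = 1" "B ** h = smult_mat w (h ** B)"
      using assms(2) h unfolding B(2) pi_n_in_Z_iff by blast
    have nz: "v \<noteq> 0" "w \<noteq> 0" using v(1) w(1) by (auto simp: zero_power)
    have [simp]: "inverse w * inverse v * w * v = 1" using nz by (simp add: field_simps)
    note comm = v(2) w(2) matrix_inv_scalar_commute[OF A(1) nz(1) v(2)] matrix_inv_scalar_commute[OF B(1) nz(2) w(2)]
    show ?thesis
      by (simp add: C_def comm comm[THEN matrix_mult_assoc_cong] flip: matrix_mul_assoc)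
  qed
  moreover have "irreducible_SL (\<Union>H)"
    using irreducible by (simp add: irreducible_PSL_def psl_preimage_def)
  ultimately obtain z where z: "C = mat z" using schur by blast
  have "C \<in> SL" unfolding C_def by (intro SL_mult A(1) B(1) Ai Bi)
  then have "z ^ CARD('n) = 1"
    unfolding z mat_eq_smult[of z] by (simp add: SL_def det_smult_mat)
  moreover have "A ** B = C ** (B ** A)"
    by (simp add: C_def Ai Bi Ai(1,2)[THEN matrix_mult_assoc_cong] Bi(1,2)[THEN matrix_mult_assoc_cong]
        flip: matrix_mul_assoc)
  ultimately show ?thesis by (auto simp: z mat_mult_eq_smult)
qed

text \<open>A lift commuting with the whole preimage would be scalar, so its class would be trivial.
  Hence conjugation by some \<open>h\<close> multiplies \<open>A\<close> by a scalar other than 1,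
  while it preserves the trace.\<close>

lemma trace_lift_eq_0:
  assumes a: "a \<in> Z" "A \<in> a" "a \<noteq> pi_n (mat 1)"
  shows "trace A = 0"
proof -
  have A: "A \<in> SL" "a = pi_n A" using a Z_lift by blast+
  have "\<exists>h\<in>\<Union>H. A ** h \<noteq> h ** A"
  proof (rule ccontr)
    assume "\<not> ?thesis"
    then obtain c where c: "A = mat c"
      using schur[of "\<Union>H" A] irreducible by (auto simp: irreducible_PSL_def psl_preimage_def)
    then have "c ^ CARD('n) = 1" using A(1) by (simp add: SL_def mat_eq_smult[of c] det_smult_mat)
    then have "pi_n A = pi_n (mat 1)" unfolding pi_n_eq_iff c mat_eq_smult[of c] by blast
    with a(3) A(2) show False by simp
  qed
  then obtain h where h: "h \<in> \<Union>H" "A ** h \<noteq> h ** A" by blast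
  have "h \<in> SL" using h(1) subgroup PSL_lift_SL by (auto simp: psl_subgroup_def)
  note hi = SL_inverse[OF this]
  obtain z where z: "A ** h = smult_mat z (h ** A)"
    using a(1) h(1) unfolding A(2) pi_n_in_Z_iff by blast
  have "A = A ** h ** matrix_inv h" using hi by (simp flip: matrix_mul_assoc)
  also have "\<dots> = smult_mat z (h ** (A ** matrix_inv h))" by (simp add: z matrix_mul_assoc)
  finally have "trace A = z * trace (h ** (A ** matrix_inv h))"
    by (metis trace_smult_mat)
  also have "trace (h ** (A ** matrix_inv h)) = trace A"
    using hi by (simp add: trace_mul_sym[of h]) (simp flip: matrix_mul_assoc)
  finally show ?thesis using z h(2) by auto
qed

lemma finite_Z: "finite Z"
proof -
  define x where "x a = (SOME A. A \<in> a)" for a :: "'n cmat set"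
  have x: "x a \<in> a" if "a \<in> Z" for a
    using PSL_nonempty[OF Z_PSL[OF that]] unfolding x_def by (rule someI_ex)
  have inj: "inj_on x Z" using x Z_lift by (metis inj_onI)
  have trace_orth: "trace (x a ** matrix_inv (x b)) = 0" if ab: "a \<in> Z" "b \<in> Z" "a \<noteq> b" for a b
  proof (rule trace_lift_eq_0)
    have a: "x a \<in> SL" "a = pi_n (x a)" and b: "x b \<in> SL" "b = pi_n (x b)"
      using x Z_lift ab by blast+
    show "pi_n (x a ** matrix_inv (x b)) \<in> Z"
      using Z_closed[OF ab(1) Z_inverse[OF ab(2) x[OF ab(2)]]] a(2) by (metis psl_mult_pi_n)
    show "x a ** matrix_inv (x b) \<in> pi_n (x a ** matrix_inv (x b))" by (rule pi_n_self)
    show "pi_n (x a ** matrix_inv (x b)) \<noteq> pi_n (mat 1)"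
    proof
      assume "pi_n (x a ** matrix_inv (x b)) = pi_n (mat 1)"
      then have "psl_mult (pi_n (x a ** matrix_inv (x b))) (pi_n (x b)) =
          psl_mult (pi_n (mat 1)) (pi_n (x b))" by simp
      then have "pi_n (x a) = pi_n (x b)"
        using SL_left_inverse[OF b(1)] by (simp add: psl_mult_pi_n flip: matrix_mul_assoc)
      then show False using a b ab(3) by simp
    qed
  qed
  \<comment> \<open>Real independence suffices for finiteness, as the matrices form a
    finite-dimensional real space. Multiplying a relation by \<open>matrix_inv A\<close> and taking
    the trace isolates the coefficient of \<open>A\<close>.\<close>
  have "independent (x ` Z)"
  proof
    assume "dependent (x ` Z)"
    then obtain T u A where T: "finite T" "T \<subseteq> x ` Z" "(\<Sum>v\<in>T. u v *\<^sub>R v) = 0" "A \<in> T" "u A \<noteq> 0"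
      by (auto simp: dependent_explicit)
    obtain b where b: "b \<in> Z" "A = x b" using T by blast
    have bi: "x b ** matrix_inv (x b) = mat 1" using SL_right_inverse x[OF b(1)] Z_lift[OF b(1)] by blast
    have "0 = trace ((\<Sum>v\<in>T. u v *\<^sub>R v) ** matrix_inv A)" using T(3) by (simp add: trace_def)
    also have "\<dots> = (\<Sum>v\<in>T. u v *\<^sub>R trace (v ** matrix_inv A))"
      by (simp add: matrix_sum_left trace_sum)
        (simp add: trace_def matrix_matrix_mult_def scaleR_sum_right)
    also have "\<dots> = (\<Sum>v\<in>T. if v = A then u A *\<^sub>R of_nat CARD('n) else 0)"
    proof (rule sum.cong[OF refl])
      fix v assume "v \<in> T"
      then obtain a where "a \<in> Z" "v = x a" using T(2) by blast
      then show "u v *\<^sub>R trace (v ** matrix_inv A) = (if v = A then u A *\<^sub>R of_nat CARD('n) else 0)"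
        using trace_orth[of a b] b bi by (auto simp: trace_I)
    qed
    also have "\<dots> = u A *\<^sub>R of_nat CARD('n)" using T(1,4) by simp
    finally show False using T(5) by simp
  qed
  then have "finite (x ` Z)" by (rule independent_imp_finite)
  then show ?thesis using inj by (rule finite_imageD)
qed

end

section \<open>The alternate form computed on arbitrary lifts\<close>

context irreducible_psl_subgroup
begin

text \<open>The lifts chosen by \<open>SOME\<close> differ from \<open>A\<close> and
  \<open>B\<close> by scalars, which drop out of the commutation relation. The bound on
  \<open>k\<close> makes the exponent unique, so the \<open>THE\<close> is determined.\<close>

lemma alt_form_eqI:
  assumes ab: "a \<in> Z" "b \<in> Z" "A \<in> a" "B \<in> b" and k: "k < CARD('n)"
    and comm: "A ** B = smult_mat (cis (2 * pi * real k / real CARD('n))) (B ** A)"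
  shows "alt_form a b = of_nat k / of_nat CARD('n)"
proof -
  define \<omega> where "\<omega> j = cis (2 * pi * real j / real CARD('n))" for j
  define X where "X = (SOME x. x \<in> a)"
  define Y where "Y = (SOME y. y \<in> b)"
  have X: "X \<in> a" unfolding X_def using ab(3) by (rule someI)
  have Y: "Y \<in> b" unfolding Y_def using ab(4) by (rule someI)
  have SL: "X \<in> SL" "Y \<in> SL" using X Y ab Z_lift by blast+
  have "X \<in> pi_n A" "Y \<in> pi_n B" using X Y ab Z_lift by blast+
  then obtain s t where st: "X = smult_mat s A" "Y = smult_mat t B" by (auto simp: pi_n_eq)
  have XY: "X ** Y = smult_mat (\<omega> k) (Y ** X)" by (simp add: st comm \<omega>_def mult_ac)
  have nz: "Y ** X \<noteq> 0" using SL by (intro SL_nonzero SL_mult)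
  note inv = SL_inverse[OF SL(1)] SL_inverse[OF SL(2)]
  have iff: "X ** Y ** matrix_inv X ** matrix_inv Y = root_scalar j \<longleftrightarrow> \<omega> j = \<omega> k" for j
  proof
    assume "X ** Y ** matrix_inv X ** matrix_inv Y = root_scalar j"
    then have "X ** Y ** matrix_inv X ** matrix_inv Y ** (Y ** X) = mat (\<omega> j) ** (Y ** X)"
      by (simp add: root_scalar_def \<omega>_def)
    then have "smult_mat (\<omega> k) (Y ** X) = smult_mat (\<omega> j) (Y ** X)"
      by (simp add: mat_mult_eq_smult XY inv inv(1,2,4,5)[THEN matrix_mult_assoc_cong]
          flip: matrix_mul_assoc)
    then show "\<omega> j = \<omega> k" using nz by (simp add: smult_mat_cancel)
  next
    assume "\<omega> j = \<omega> k"
    then show "X ** Y ** matrix_inv X ** matrix_inv Y = root_scalar j"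
      by (simp add: XY root_scalar_def mat_eq_smult[of "\<omega> k"] inv inv(1,2,4,5)[THEN matrix_mult_assoc_cong]
          flip: matrix_mul_assoc \<omega>_def)
  qed
  have inj: "j = k" if "\<omega> j = \<omega> k" "j < CARD('n)" for j
    using that k bij_betw_imp_inj_on[OF roots_unity_bij[where 'n='n]]
    by (auto simp: inj_on_def \<omega>_def)
  have "alt_form a b = (THE q. \<exists>k<CARD('n). q = of_nat k / of_nat CARD('n) \<and>
      X ** Y ** matrix_inv X ** matrix_inv Y = root_scalar k)"
    by (simp add: alt_form_def Let_def X_def Y_def)
  also have "\<dots> = of_nat k / of_nat CARD('n)"
    unfolding iff using k inj by (intro the_equality) auto
  finally show ?thesis .
qed

lemma alt_form_exists:
  assumes ab: "a \<in> Z" "b \<in> Z" "A \<in> a" "B \<in> b"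
  obtains k where "k < CARD('n)" "A ** B = smult_mat (cis (2 * pi * real k / real CARD('n))) (B ** A)"
    "alt_form a b = of_nat k / of_nat CARD('n)"
proof -
  obtain z where z: "z ^ CARD('n) = 1" "A ** B = smult_mat z (B ** A)"
    using commutator_scalar[OF ab] by blast
  obtain k where "k < CARD('n)" "z = cis (2 * pi * real k / real CARD('n))"
    using z(1) roots_unity_bij[where 'n='n] by (auto simp: bij_betw_def set_eq_iff image_iff)
  with z(2) alt_form_eqI[OF ab] that show ?thesis by blast
qed

text \<open>The commutator scalar becomes a function of the value of the form, so equal values give
  equal scalars for lifts in different centralizers.\<close>

lemma alt_form_commute:
  assumes ab: "a \<in> Z" "b \<in> Z" "A \<in> a" "B \<in> b"
  shows "A ** B = smult_mat (cis (2 * pi * real_of_rat (alt_form a b))) (B ** A)"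
  using alt_form_exists[OF ab] by (metis of_rat_divide of_rat_of_nat_eq times_divide_eq_right)

end

section \<open>Conjugacy versus isometry\<close>

lemma conjugate_imp_isometric:
  fixes H1 H2 :: "('n::finite) cmat set set"
  assumes "irreducible_psl_subgroup H1" "irreducible_psl_subgroup H2"
    and conj: "psl_conjugate (psl_centralizer H1) (psl_centralizer H2)"
  shows "alt_isometric (psl_centralizer H1) alt_form (psl_centralizer H2) alt_form"
proof -
  interpret Z1: irreducible_psl_subgroup H1 by fact
  interpret Z2: irreducible_psl_subgroup H2 by fact
  obtain g where g: "g \<in> PSL"
    "(\<lambda>z. psl_mult (psl_mult g z) (psl_inv g)) ` psl_centralizer H1 = psl_centralizer H2"
    using conj by (auto simp: psl_conjugate_def)
  define f where "f z = psl_mult (psl_mult g z) (psl_inv g)" for z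
  obtain G where "G \<in> g" using PSL_nonempty[OF g(1)] by blast
  then have G: "G \<in> SL" "g = pi_n G" using g(1) PSL_lift_SL PSL_eq_pi_n by blast+
  note Gi = SL_inverse[OF G(1)]
  note Gi' = Gi(1,2)[THEN matrix_mult_assoc_cong]
  \<comment> \<open>On lifts, \<open>f\<close> is conjugation by \<open>G\<close>. It respects
    products and scalars, so a commutation relation is carried over with the same root of
    unity.\<close>
  define F where "F A = G ** A ** matrix_inv G" for A
  have f_pi: "f (pi_n A) = pi_n (F A)" for A
    by (simp add: f_def G(2) psl_inv_pi_n[OF G(1)] psl_mult_pi_n F_def)
  have F_mult: "F A ** F B = F (A ** B)" for A B
    by (simp add: F_def Gi' flip: matrix_mul_assoc)
  have F_smult: "F (smult_mat z A) = smult_mat z (F A)" for z A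
    by (simp add: F_def)
  have F_inj: "A = B" if "F A = F B" for A B
  proof -
    have "matrix_inv G ** F A ** G = matrix_inv G ** F B ** G" by (simp add: that)
    then show ?thesis by (simp add: F_def Gi Gi' flip: matrix_mul_assoc)
  qed
  have f_lift: "F A \<in> f a" if "a \<in> psl_centralizer H1" "A \<in> a" for a A
    using f_pi[of A] pi_n_self[of "F A"] Z1.Z_lift[OF that] by simp
  have lift: "\<exists>A. A \<in> a \<and> a = pi_n A" if "a \<in> psl_centralizer H1" for a
    using that Z1.Z_PSL Z1.Z_lift PSL_nonempty by meson
  have img: "f ` psl_centralizer H1 = psl_centralizer H2" using g(2) by (simp add: f_def)
  have "inj_on f (psl_centralizer H1)"
  proof
    fix a b assume "a \<in> psl_centralizer H1" "b \<in> psl_centralizer H1" and eq: "f a = f b"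
    then obtain A B where AB: "a = pi_n A" "b = pi_n B" using lift by meson
    then obtain z where "z ^ CARD('n) = 1" "F A = F (smult_mat z B)"
      using eq by (auto simp: f_pi pi_n_eq_iff F_smult)
    then show "a = b" using F_inj unfolding AB pi_n_eq_iff by blast
  qed
  with img have "bij_betw f (psl_centralizer H1) (psl_centralizer H2)" by (simp add: bij_betw_def)
  moreover have "f (psl_mult a b) = psl_mult (f a) (f b)"
    if ab: "a \<in> psl_centralizer H1" "b \<in> psl_centralizer H1" for a b
  proof -
    obtain A B where "a = pi_n A" "b = pi_n B" using lift ab by meson
    then show ?thesis by (simp add: psl_mult_pi_n f_pi F_mult)
  qed
  moreover have "alt_form (f a) (f b) = alt_form a b"
    if ab: "a \<in> psl_centralizer H1" "b \<in> psl_centralizer H1" for a b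
  proof -
    obtain A B where AB: "A \<in> a" "B \<in> b" using lift ab by meson
    obtain k where k: "k < CARD('n)"
      "A ** B = smult_mat (cis (2 * pi * real k / real CARD('n))) (B ** A)"
      "alt_form a b = of_nat k / of_nat CARD('n)"
      using Z1.alt_form_exists[OF ab AB] .
    have "F A ** F B = smult_mat (cis (2 * pi * real k / real CARD('n))) (F B ** F A)"
      by (simp add: F_mult k(2) F_smult)
    then have "alt_form (f a) (f b) = of_nat k / of_nat CARD('n)"
      using ab AB img k(1) f_lift by (intro Z2.alt_form_eqI[of _ _ "F A" "F B"]) auto
    then show ?thesis by (simp add: k(3))
  qed
  ultimately show ?thesis unfolding alt_isometric_def by blast
qed

lemma isometric_imp_conjugate:
  fixes H1 H2 :: "('n::finite) cmat set set"
  assumes "irreducible_psl_subgroup H1" "irreducible_psl_subgroup H2"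
    and iso: "alt_isometric (psl_centralizer H1) alt_form (psl_centralizer H2) alt_form"
  shows "psl_conjugate (psl_centralizer H1) (psl_centralizer H2)"
proof -
  interpret Z1: irreducible_psl_subgroup H1 by fact
  interpret Z2: irreducible_psl_subgroup H2 by fact
  let ?A = "psl_centralizer H1"
  obtain f where f_iso: "bij_betw f ?A (psl_centralizer H2) \<and>
      (\<forall>a\<in>?A. \<forall>b\<in>?A. f (psl_mult a b) = psl_mult (f a) (f b)) \<and>
      (\<forall>a\<in>?A. \<forall>b\<in>?A. alt_form (f a) (f b) = alt_form a b)"
    using iso unfolding alt_isometric_def by (elim exE)
  have f: "bij_betw f ?A (psl_centralizer H2)"
    "\<And>a b. a \<in> ?A \<Longrightarrow> b \<in> ?A \<Longrightarrow> f (psl_mult a b) = psl_mult (f a) (f b)"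
    "\<And>a b. a \<in> ?A \<Longrightarrow> b \<in> ?A \<Longrightarrow> alt_form (f a) (f b) = alt_form a b"
    using f_iso by simp_all
  have f_Z: "f a \<in> psl_centralizer H2" if "a \<in> ?A" for a
    using f(1) that by (auto simp: bij_betw_def)
  define x where "x a = (SOME A. A \<in> a)" for a :: "'n cmat set"
  have x: "x a \<in> a" if "a \<in> PSL" for a
    using PSL_nonempty[OF that] unfolding x_def by (rule someI_ex)
  define y where "y a = x (f a)" for a
  have xa: "x a \<in> a" "x a \<in> SL" "a = pi_n (x a)" if "a \<in> ?A" for a
  proof -
    show a: "x a \<in> a" using that by (intro x Z1.Z_PSL)
    show "x a \<in> SL" "a = pi_n (x a)" using Z1.Z_lift[OF that a] by (blast, rule conjunct2)
  qed
  have ya: "y a \<in> f a" "y a \<in> SL" "f a = pi_n (y a)" if "a \<in> ?A" for a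
  proof -
    show a: "y a \<in> f a" unfolding y_def using that by (intro x Z2.Z_PSL f_Z)
    show "y a \<in> SL" "f a = pi_n (y a)"
      using Z2.Z_lift[OF f_Z[OF that] a] by (blast, rule conjunct2)
  qed
  have scalar: "\<exists>z. z \<noteq> 0 \<and> A ** B = smult_mat z C"
    if "psl_mult a b = pi_n C" "a = pi_n A" "b = pi_n B" for a b and A B C :: "'n cmat"
  proof -
    have "pi_n (A ** B) = pi_n C" using that(1) by (simp add: that(2,3) psl_mult_pi_n)
    then obtain z where "z ^ CARD('n) = 1" "A ** B = smult_mat z C"
      unfolding pi_n_eq_iff by blast
    then show ?thesis by (intro exI[of _ z]) (auto simp: zero_power)
  qed
  have "\<exists>z. z \<noteq> 0 \<and> x a ** x b = smult_mat z (x (psl_mult a b))" if "a \<in> ?A" "b \<in> ?A" for a b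
    using that by (intro scalar[of a b] xa(3) Z1.Z_closed)
  then obtain c where c: "\<And>a b. a \<in> ?A \<Longrightarrow> b \<in> ?A \<Longrightarrow> c a b \<noteq> 0"
    "\<And>a b. a \<in> ?A \<Longrightarrow> b \<in> ?A \<Longrightarrow> x a ** x b = smult_mat (c a b) (x (psl_mult a b))"
    by metis
  have "\<exists>z. z \<noteq> 0 \<and> y a ** y b = smult_mat z (y (psl_mult a b))"
    if ab: "a \<in> ?A" "b \<in> ?A" for a b
  proof (rule scalar[of "f a" "f b"])
    show "psl_mult (f a) (f b) = pi_n (y (psl_mult a b))"
      using ya(3)[OF Z1.Z_closed[OF ab]] f(2)[OF ab] by simp
  qed (use ab ya(3) in blast)+
  then obtain d where d: "\<And>a b. a \<in> ?A \<Longrightarrow> b \<in> ?A \<Longrightarrow> y a ** y b = smult_mat (d a b) (y (psl_mult a b))"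
    by metis
  interpret G: finite_cancel_magma ?A psl_mult c
  proof
    show "finite ?A" by (rule Z1.finite_Z)
    show "?A \<noteq> {}" using Z1.pi_n_1_in_Z by blast
    show "psl_mult a b \<in> ?A" if "a \<in> ?A" "b \<in> ?A" for a b using that by (rule Z1.Z_closed)
    show "c a b \<noteq> 0" if "a \<in> ?A" "b \<in> ?A" for a b using that by (rule c(1))
    show "inj_on (psl_mult a) ?A" if a: "a \<in> ?A" for a
    proof
      fix b b' assume b: "b \<in> ?A" "b' \<in> ?A" and eq: "psl_mult a b = psl_mult a b'"
      have *: "psl_mult (pi_n (matrix_inv (x a))) (psl_mult a b) = b" if b: "b \<in> ?A" for b
      proof -
        have "psl_mult (pi_n (matrix_inv (x a))) (psl_mult (pi_n (x a)) (pi_n (x b))) = pi_n (x b)"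
          by (simp only: psl_mult_pi_n matrix_mul_assoc SL_left_inverse[OF xa(2)[OF a]] matrix_mul_lid)
        then show ?thesis by (simp only: xa(3)[OF a, symmetric] xa(3)[OF b, symmetric])
      qed
      show "b = b'" using *[OF b(1)] *[OF b(2)] unfolding eq by (rule box_equals[OF refl])
    qed
  qed
  \<comment> \<open>\<open>f\<close> maps the identity to an idempotent of the group. With
    injectivity, nontrivial elements then go to nontrivial ones, so that lifts on both sides have
    trace 0 at the same places.\<close>
  have f_one: "f (pi_n (mat 1)) = pi_n (mat 1)"
  proof -
    let ?e = "pi_n (mat 1 :: 'n cmat)"
    note e = Z1.pi_n_1_in_Z
    define Y where "Y = y ?e"
    have Y: "f ?e = pi_n Y" "Y \<in> SL" using ya[OF e] by (simp_all add: Y_def)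
    have "psl_mult (f ?e) (f ?e) = f ?e" using f(2)[OF e e] by (simp add: psl_mult_pi_n)
    then have "psl_mult (pi_n (matrix_inv Y)) (psl_mult (pi_n Y) (pi_n Y)) =
        psl_mult (pi_n (matrix_inv Y)) (pi_n Y)" by (simp add: Y(1))
    then have "pi_n Y = pi_n (mat 1)"
      using SL_left_inverse[OF Y(2)] by (simp add: psl_mult_pi_n matrix_mul_assoc)
    then show ?thesis by (simp add: Y(1))
  qed
  \<comment> \<open>One scalar function serves both families, because \<open>f\<close> preserves the
    form.\<close>
  define e where "e a b = cis (2 * pi * real_of_rat (alt_form a b))" for a b :: "'n cmat set"
  have "\<exists>X \<mu>. invertible X \<and> (\<forall>a\<in>?A. y a ** X = smult_mat (\<mu> a) (X ** x a))"
  proof (rule G.equal_commutator_imp_equivalent)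
    show "G.twisted_rep x (\<lambda>a. matrix_inv (x a))"
      using c(2) xa(2) SL_right_inverse by (auto simp: G.twisted_rep_def)
    show "y a ** matrix_inv (y a) = mat 1" if "a \<in> ?A" for a
      using ya(2)[OF that] by (rule SL_right_inverse)
    show "y a ** y b = smult_mat (d a b) (y (psl_mult a b))" if "a \<in> ?A" "b \<in> ?A" for a b
      using that by (rule d)
    show "x a ** x b = smult_mat (e a b) (x b ** x a)" if "a \<in> ?A" "b \<in> ?A" for a b
      unfolding e_def using that xa(1) by (intro Z1.alt_form_commute)
    show "y a ** y b = smult_mat (e a b) (y b ** y a)" if ab: "a \<in> ?A" "b \<in> ?A" for a b
      unfolding e_def f(3)[OF ab, symmetric] using ab ya(1) f_Z by (intro Z2.alt_form_commute)
    show "e a b \<noteq> 0" for a b by (simp add: e_def)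
    show "trace (x a) = 0 \<and> trace (y a) = 0 \<or> (\<exists>s t. x a = mat s \<and> y a = mat t)"
      if a: "a \<in> ?A" for a
    proof (cases "a = pi_n (mat 1)")
      case True
      then have "x a \<in> pi_n (mat 1)" "y a \<in> pi_n (mat 1)"
        using xa(1)[OF a] ya(1)[OF a] f_one by auto
      then show ?thesis by (auto simp: pi_n_eq simp flip: mat_eq_smult)
    next
      case False
      then have "f a \<noteq> pi_n (mat 1)"
        using f(1) a Z1.pi_n_1_in_Z f_one by (metis bij_betw_imp_inj_on inj_on_def)
      then show ?thesis
        using False a f_Z[OF a] xa(1)[OF a] ya(1)[OF a] Z1.trace_lift_eq_0 Z2.trace_lift_eq_0 by blast
    qed
  qed
  then obtain X \<mu> where X: "invertible X" "\<And>a. a \<in> ?A \<Longrightarrow> y a ** X = smult_mat (\<mu> a) (X ** x a)"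
    by blast
  have "det X \<noteq> 0" using X(1) by (simp add: invertible_det_nz)
  then obtain t where t: "t ^ CARD('n) = inverse (det X)"
    using exists_complex_root[of "inverse (det X)" "CARD('n)"] by auto
  define G where "G = smult_mat t X"
  have G: "G \<in> SL" using t \<open>det X \<noteq> 0\<close> by (simp add: G_def SL_def det_smult_mat)
  have yG: "y a ** G = smult_mat (\<mu> a) (G ** x a)" if "a \<in> ?A" for a
    by (simp only: G_def smult_mat_mult_left smult_mat_mult_right X(2)[OF that]
        smult_mat_smult_mat mult.commute)
  have "psl_mult (psl_mult (pi_n G) a) (psl_inv (pi_n G)) = f a" if a: "a \<in> ?A" for a
  proof -
    \<comment> \<open>All lifts and \<open>G\<close> have determinant 1, so comparing determinants
      makes \<open>\<mu> a\<close> an n-th root of unity; it therefore disappears in PSL.\<close>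
    have "det (y a ** G) = det (smult_mat (\<mu> a) (G ** x a))" by (simp add: yG[OF a])
    then have mu: "\<mu> a ^ CARD('n) = 1"
      using G xa(2)[OF a] ya(2)[OF a] by (simp add: SL_def det_mul det_smult_mat)
    have "y a = y a ** G ** matrix_inv G"
      using SL_right_inverse[OF G] by (simp flip: matrix_mul_assoc)
    also have "\<dots> = smult_mat (\<mu> a) (G ** x a ** matrix_inv G)" by (simp add: yG[OF a])
    finally have "pi_n (y a) = pi_n (G ** x a ** matrix_inv G)"
      unfolding pi_n_eq_iff using mu by (intro exI conjI)
    moreover have "psl_mult (psl_mult (pi_n G) (pi_n (x a))) (psl_inv (pi_n G)) =
        pi_n (G ** x a ** matrix_inv G)"
      by (simp add: psl_inv_pi_n[OF G] psl_mult_pi_n)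
    ultimately show ?thesis by (simp only: xa(3)[OF a, symmetric] ya(3)[OF a, symmetric])
  qed
  then have "(\<lambda>z. psl_mult (psl_mult (pi_n G) z) (psl_inv (pi_n G))) ` ?A = f ` ?A"
    by (intro image_cong refl)
  also have "\<dots> = psl_centralizer H2" using f(1) by (simp add: bij_betw_def)
  finally show ?thesis unfolding psl_conjugate_def using pi_n_PSL[OF G] by blast
qed

theorem mainTheorem9:
  fixes H1 H2 :: "('n::finite) cmat set set"
  assumes "psl_subgroup H1" and "irreducible_PSL H1"
      and "psl_subgroup H2" and "irreducible_PSL H2"
  shows "psl_conjugate (psl_centralizer H1) (psl_centralizer H2) \<longleftrightarrow>
         alt_isometric (psl_centralizer H1) alt_form (psl_centralizer H2) alt_form"
proof -
  have "irreducible_psl_subgroup H1" "irreducible_psl_subgroup H2"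
    using assms by (simp_all add: irreducible_psl_subgroup_def)
  then show ?thesis using conjugate_imp_isometric isometric_imp_conjugate by (intro iffI)
qed

end
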